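(* Let $E,F$ be Banach spaces. Each of the sets $F_k$, $\Phi_{m,n}$, $\Phi_{m,\infty}$ and $\Phi_{\infty,n}$ (with $k,m,n<\infty$) is a smooth submanifold of $B(E,F)$ and is tangent to $M(X)$ at every $X$ in it, where $M(X)=\{T\in B(E,F): TN(X)\subset R(X)\}$.
   Context: $B(E,F)$ is the Banach space of bounded linear operators from $E$ to $F$; $N(\cdot)$, $R(\cdot)$ denote null space and range. The family $M(X)$ is considered for $X\in\Lambda=B(E,F)\setminus\{0\}$. $F_k=\{T\in B(E,F):\operatorname{rank}T=k\}$; $\Phi_{m,n}$ is the set of Fredholm operators $T$ with $\dim N(T)=m$ and $\operatorname{codim}R(T)=n$; $\Phi_{m,\infty}$ is the set of semi-Fredholm operators $T$ with $\dim N(T)=m$, $\operatorname{codim}R(T)=\infty$; $\Phi_{\infty,n}$ is the set of semi-Fredholm operators $T$ with $\dim N(T)=\infty$, $\operatorname{codim}R(T)=n$. Semi-Fredholm operators are understood to be double splitting: $R(T)$ is closed and both $N(T)$ and $R(T)$ have closed complements in $E$ and $F$ respectively. A subset $S$ of a Banach space $\mathbb B$ is a smooth submanifold if around each of its points there are an open neighborhood $W$ in $\mathbb B$, a splitting $\mathbb B=\mathbb B_0\oplus\mathbb B_1$ into closed subspaces, and a smooth diffeomorphism $\varphi$ of $W$ onto an open subset of $\mathbb B$ such that $\varphi(S\cap W)$ is an open subset of $\mathbb B_0$ (the splitting may depend on the point). $S$ is tangent to a subspace $M$ at $X\in S$ if $M=\{\dot c(0): c(t)\subset S\text{ a }C^1\text{-curve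 with }c(0)=X\}$. *)

theory Defs
  imports "HOL-Analysis.Analysis"
begin

text \<open>The library's \<^const>\<open>dim\<close> is a natural number and is not informative on
  infinite-dimensional subspaces, so the value \<open>\<infinity>\<close> is added.\<close>

definition edim :: "'a::real_vector set \<Rightarrow> enat" where
  "edim V = (if \<exists>B. finite B \<and> V \<subseteq> span B then enat (dim V) else \<infinity>)"

definition algebraic_complement :: "'a::real_vector set \<Rightarrow> 'a set \<Rightarrow> bool" where
  "algebraic_complement V W \<longleftrightarrow>
     subspace V \<and> subspace W \<and> V \<inter> W = {0} \<and> (\<forall>x. \<exists>v\<in>V. \<exists>w\<in>W. x = v + w)"

text \<open>The codimension of \<open>V\<close> is the dimension of the quotient by \<open>V\<close>, realised as the dimension of
  an algebraic complement; complements exist and are all isomorphic to the quotient.\<close>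

definition has_codim :: "'a::real_vector set \<Rightarrow> enat \<Rightarrow> bool" where
  "has_codim V d \<longleftrightarrow> (\<exists>W. algebraic_complement V W \<and> edim W = d)"

definition splitting :: "'a::real_normed_vector set \<Rightarrow> 'a set \<Rightarrow> bool" where
  "splitting V W \<longleftrightarrow> closed V \<and> closed W \<and> algebraic_complement V W"

definition null_space :: "('a::real_normed_vector \<Rightarrow>\<^sub>L 'b::real_normed_vector) \<Rightarrow> 'a set" where
  "null_space T = {x. blinfun_apply T x = 0}"

definition range_space :: "('a::real_normed_vector \<Rightarrow>\<^sub>L 'b::real_normed_vector) \<Rightarrow> 'b set" where
  "range_space T = range (blinfun_apply T)"

definition fredholm :: "('a::banach \<Rightarrow>\<^sub>L 'b::banach) \<Rightarrow> bool" where
  "fredholm T \<longleftrightarrow> edim (null_space T) \<noteq> \<infinity> \<and> (\<exists>n. has_codim (range_space T) (enat n))"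

definition double_splitting :: "('a::banach \<Rightarrow>\<^sub>L 'b::banach) \<Rightarrow> bool" where
  "double_splitting T \<longleftrightarrow> closed (range_space T) \<and>
     (\<exists>W. splitting (null_space T) W) \<and> (\<exists>W. splitting (range_space T) W)"

definition semi_fredholm :: "('a::banach \<Rightarrow>\<^sub>L 'b::banach) \<Rightarrow> bool" where
  "semi_fredholm T \<longleftrightarrow> double_splitting T \<and>
     (edim (null_space T) \<noteq> \<infinity> \<or> (\<exists>n. has_codim (range_space T) (enat n)))"

definition rank_set :: "nat \<Rightarrow> ('a::banach \<Rightarrow>\<^sub>L 'b::banach) set" where
  "rank_set k = {T. edim (range_space T) = enat k}"

definition Phi_fin_fin :: "nat \<Rightarrow> nat \<Rightarrow> ('a::banach \<Rightarrow>\<^sub>L 'b::banach) set" where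
  "Phi_fin_fin m n =
     {T. fredholm T \<and> edim (null_space T) = enat m \<and> has_codim (range_space T) (enat n)}"

definition Phi_fin_inf :: "nat \<Rightarrow> ('a::banach \<Rightarrow>\<^sub>L 'b::banach) set" where
  "Phi_fin_inf m =
     {T. semi_fredholm T \<and> edim (null_space T) = enat m \<and> has_codim (range_space T) \<infinity>}"

definition Phi_inf_fin :: "nat \<Rightarrow> ('a::banach \<Rightarrow>\<^sub>L 'b::banach) set" where
  "Phi_inf_fin n =
     {T. semi_fredholm T \<and> edim (null_space T) = \<infinity> \<and> has_codim (range_space T) (enat n)}"

definition M_space :: "('a::banach \<Rightarrow>\<^sub>L 'b::banach) \<Rightarrow> ('a \<Rightarrow>\<^sub>L 'b) set" where
  "M_space X = {T. blinfun_apply T ` null_space X \<subseteq> range_space X}"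

text \<open>Bounded \<open>n\<close>-linear maps are encoded as functions on lists, of which only the values on lists
  of length \<open>n\<close> matter.\<close>

definition bounded_multilinear ::
  "nat \<Rightarrow> ('a::real_normed_vector list \<Rightarrow> 'b::real_normed_vector) \<Rightarrow> bool" where
  "bounded_multilinear n A \<longleftrightarrow>
     (\<forall>us vs. length us + length vs + 1 = n \<longrightarrow> linear (\<lambda>v. A (us @ v # vs))) \<and>
     (\<exists>K. \<forall>vs. length vs = n \<longrightarrow> norm (A vs) \<le> K * prod_list (map norm vs))"

text \<open>\<open>D n x\<close> is the \<open>n\<close>-th Frechet derivative of \<open>f\<close> at \<open>x\<close>. The types of the iterated derivatives
  depend on \<open>n\<close>, so, as usual, a bounded linear map into the bounded \<open>n\<close>-linear maps is identified
  with a bounded \<open>(n + 1)\<close>-linear map, the new argument coming first. The last conjunct states that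
  \<open>D n\<close> is Frechet differentiable at \<open>x\<close> with respect to the operator norm on \<open>n\<close>-linear maps, with
  derivative \<open>D (Suc n) x\<close>. The set \<open>U\<close> is meant to be open.\<close>

definition smooth_map_on ::
  "'a::real_normed_vector set \<Rightarrow> ('a \<Rightarrow> 'b::real_normed_vector) \<Rightarrow> bool" where
  "smooth_map_on U f \<longleftrightarrow> (\<exists>D :: nat \<Rightarrow> 'a \<Rightarrow> 'a list \<Rightarrow> 'b.
     (\<forall>x\<in>U. D 0 x [] = f x) \<and>
     (\<forall>n. \<forall>x\<in>U. bounded_multilinear n (D n x)) \<and>
     (\<forall>n. \<forall>x\<in>U. \<forall>\<epsilon>>0. \<exists>\<delta>>0. \<forall>y\<in>U. norm (y - x) < \<delta> \<longrightarrow>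
        (\<forall>vs. length vs = n \<longrightarrow>
           norm (D n y vs - D n x vs - D (Suc n) x ((y - x) # vs))
             \<le> \<epsilon> * norm (y - x) * prod_list (map norm vs))))"

definition smooth_diffeo ::
  "'a::real_normed_vector set \<Rightarrow> 'b::real_normed_vector set \<Rightarrow> ('a \<Rightarrow> 'b) \<Rightarrow> bool" where
  "smooth_diffeo U V \<phi> \<longleftrightarrow> open U \<and> open V \<and> bij_betw \<phi> U V \<and>
     smooth_map_on U \<phi> \<and> smooth_map_on V (inv_into U \<phi>)"

definition smooth_submanifold :: "'a::banach set \<Rightarrow> bool" where
  "smooth_submanifold S \<longleftrightarrow>
     (\<forall>x\<in>S. \<exists>(W::'a set) (V::'a set) B0 B1 (\<phi>::'a \<Rightarrow> 'a). x \<in> W \<and> splitting B0 B1 \<and> smooth_diffeo W V \<phi> \<and>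
        openin (top_of_set B0) (\<phi> ` (S \<inter> W)))"

definition curve_velocities :: "'a::banach set \<Rightarrow> 'a \<Rightarrow> 'a set" where
  "curve_velocities S x =
     {vector_derivative c (at 0) | c :: real \<Rightarrow> 'a.
        \<exists>\<epsilon>>0. c C1_differentiable_on {-\<epsilon><..<\<epsilon>} \<and> c ` {-\<epsilon><..<\<epsilon>} \<subseteq> S \<and> c 0 = x}"

definition tangent_to :: "'a::banach set \<Rightarrow> 'a set \<Rightarrow> 'a \<Rightarrow> bool" where
  "tangent_to S M x \<longleftrightarrow> subspace M \<and> M = curve_velocities S x"

end

theory Submission
  imports Defs
begin

text \<open>An operator \<open>X\<close> in one of the four classes has closed complements of its null space and range,
  hence a generalized inverse \<open>A\<close> (\<open>XAX = X\<close>, \<open>AXA = A\<close>). With the projections \<open>P = 1 - AX\<close> onto the null space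
  of \<open>X\<close> and \<open>Q = 1 - XA\<close> along its range, \<open>M(X)\<close> is the kernel of the projection \<open>Y \<mapsto> QYP\<close>. The quadratic map
  \<open>Y \<mapsto> X + Y + YAYP\<close> factors as \<open>(1 + YA) (X + QYP) (1 + AYP)\<close> with invertible outer factors, and its
  local inverse is \<open>T \<mapsto> (T - X)AX + (1 + (T - X)A)\<^sup>-\<^sup>1 (T - X)P\<close>. Each class is invariant under invertible factors,
  and \<open>X + QYP\<close> lies in the class of \<open>X\<close> only if \<open>QYP = 0\<close>, by comparing the finite one among rank, nullity
  and codimension. So in this chart the class is the subspace \<open>M(X)\<close>, and the curves \<open>X + tY + t\<^sup>2 YAYP\<close>
  with \<open>Y \<in> M(X)\<close> realise all tangent vectors.\<close>

subsection \<open>Bounded functionals and complements of finite-dimensional subspaces\<close>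

definition sublinear :: "('a::real_vector \<Rightarrow> real) \<Rightarrow> bool" where
  "sublinear p \<longleftrightarrow> (\<forall>x y. p (x + y) \<le> p x + p y) \<and> (\<forall>c\<ge>0. \<forall>x. p (c *\<^sub>R x) = c * p x)"

lemma sublinear_add: "sublinear p \<Longrightarrow> p (x + y) \<le> p x + p y"
  by (simp add: sublinear_def)

lemma sublinear_scaleR: "sublinear p \<Longrightarrow> 0 \<le> c \<Longrightarrow> p (c *\<^sub>R x) = c * p x"
  by (simp add: sublinear_def)

lemma sublinear_zero: "sublinear p \<Longrightarrow> p 0 = 0"
  using sublinear_scaleR[of p 0 0] by simp

lemma sublinear_minus: "sublinear p \<Longrightarrow> - p (- x) \<le> p x"
  using sublinear_add[of p x "- x"] sublinear_zero[of p] by simp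

lemma sublinearI:
  assumes add: "\<And>x y. p (x + y) \<le> p x + p y"
    and scale: "\<And>c x. 0 < c \<Longrightarrow> p (c *\<^sub>R x) \<le> c * p x" and zero: "p 0 = 0"
  shows "sublinear p"
  unfolding sublinear_def
proof (intro conjI allI impI add)
  fix c :: real and x assume "0 \<le> c"
  show "p (c *\<^sub>R x) = c * p x"
  proof (cases "c = 0")
    case False
    then have c: "0 < c" using \<open>0 \<le> c\<close> by simp
    have "p (inverse c *\<^sub>R (c *\<^sub>R x)) \<le> inverse c * p (c *\<^sub>R x)"
      using c by (intro scale) simp
    then have "c * p x \<le> p (c *\<^sub>R x)"
      using c by (simp add: field_simps)
    then show ?thesis using scale[OF c, of x] by simp
  qed (simp add: zero)
qed

lemma sublinear_lowering:
  assumes p: "sublinear p"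
  obtains q where "sublinear q" "\<And>x. q x \<le> p x" "q (- y) \<le> - p y"
proof
  define q where "q x = (INF t\<in>{0..}. p (x + t *\<^sub>R y) - t * p y)" for x
  have bdd: "bdd_below ((\<lambda>t. p (x + t *\<^sub>R y) - t * p y) ` {0..})" for x
  proof (rule bdd_belowI2)
    fix t :: real assume "t \<in> {0..}"
    then have "t * p y = p (t *\<^sub>R y)" using sublinear_scaleR[OF p] by simp
    then show "- p (- x) \<le> p (x + t *\<^sub>R y) - t * p y"
      using sublinear_add[OF p, of "x + t *\<^sub>R y" "- x"] by simp
  qed
  have low: "q x \<le> p (x + t *\<^sub>R y) - t * p y" if "0 \<le> t" for x t
    unfolding q_def using that by (intro cINF_lower bdd) simp
  have great: "m \<le> q x" if "\<And>t. 0 \<le> t \<Longrightarrow> m \<le> p (x + t *\<^sub>R y) - t * p y" for m x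
    unfolding q_def using that by (intro cINF_greatest) auto
  show "q x \<le> p x" for x using low[of 0 x] by simp
  show "q (- y) \<le> - p y" using low[of 1 "- y"] sublinear_zero[OF p] by simp
  show "sublinear q"
  proof (rule sublinearI)
    fix x x'
    have pq: "q (x + x') - (p (x + t *\<^sub>R y) - t * p y) \<le> p (x' + s *\<^sub>R y) - s * p y"
      if "0 \<le> t" "0 \<le> s" for t s
      using low[of "t + s" "x + x'"] that
        sublinear_add[OF p, of "x + t *\<^sub>R y" "x' + s *\<^sub>R y"]
      by (simp add: algebra_simps)
    have "q (x + x') - (p (x + t *\<^sub>R y) - t * p y) \<le> q x'" if "0 \<le> t" for t
      using pq[OF that] by (rule great)
    then have "q (x + x') - q x' \<le> q x"
      by (intro great) (simp add: algebra_simps)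
    then show "q (x + x') \<le> q x + q x'" by simp
  next
    fix c :: real and x assume c: "0 < c"
    have "q (c *\<^sub>R x) / c \<le> q x"
    proof (rule great)
      fix t :: real assume "0 \<le> t"
      then have "q (c *\<^sub>R x) \<le> p (c *\<^sub>R (x + t *\<^sub>R y)) - c * t * p y"
        using low[of "c * t" "c *\<^sub>R x"] c by (simp add: algebra_simps)
      also have "\<dots> = c * (p (x + t *\<^sub>R y) - t * p y)"
        using c by (simp only: sublinear_scaleR[OF p] less_imp_le) (simp add: algebra_simps)
      finally show "q (c *\<^sub>R x) / c \<le> p (x + t *\<^sub>R y) - t * p y"
        using c by (simp add: field_simps)
    qed
    then show "q (c *\<^sub>R x) \<le> c * q x" using c by (simp add: field_simps)
  next
    have "0 \<le> q 0"
      by (rule great) (simp add: sublinear_scaleR[OF p])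
    moreover have "q 0 \<le> 0" using low[of 0 0] sublinear_zero[OF p] by simp
    ultimately show "q 0 = 0" by simp
  qed
qed

text \<open>A minimal sublinear functional coincides with all its lowerings, which makes it additive.\<close>

lemma linear_below_sublinear:
  assumes p0: "sublinear p0"
  obtains f where "linear f" "\<And>x. f x \<le> p0 x"
proof -
  define A where "A = {p. sublinear p \<and> (\<forall>x. p x \<le> p0 x)}"
  define P where "P = (\<lambda>p q :: 'a \<Rightarrow> real. \<forall>x. q x \<le> p x)"
  have "\<exists>m\<in>A. \<forall>a\<in>A. P m a \<longrightarrow> a = m"
  proof (rule predicate_Zorn)
    show "partial_order_on A (relation_of P A)"
    proof (rule partial_order_on_relation_ofI)
      show "a = b" if "P a b" "P b a" for a b
        using that by (intro ext antisym) (auto simp: P_def)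
      show "P a c" if "P a b" "P b c" for a b c
        using that unfolding P_def by (meson order_trans)
    qed (simp add: P_def)
  next
    fix C assume "C \<in> Chains (relation_of P A)"
    then have CA: "C \<subseteq> A" and tot: "\<And>p q. p \<in> C \<Longrightarrow> q \<in> C \<Longrightarrow> P p q \<or> P q p"
      unfolding Chains_def relation_of_def by auto
    show "\<exists>u\<in>A. \<forall>a\<in>C. P a u"
    proof (cases "C = {}")
      case True
      then show ?thesis using p0 by (auto simp: A_def)
    next
      case False
      define u where "u x = (INF p\<in>C. p x)" for x
      have sub: "sublinear p" if "p \<in> C" for p using that CA by (auto simp: A_def)
      have bdd: "bdd_below ((\<lambda>p. p x) ` C)" for x
      proof (rule bdd_belowI2)
        fix p assume "p \<in> C"
        then have "p (- x) \<le> p0 (- x)" using CA by (auto simp: A_def)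
        then show "- p0 (- x) \<le> p x"
          using sublinear_minus[OF sub[OF \<open>p \<in> C\<close>], of x] by simp
      qed
      have low: "u x \<le> p x" if "p \<in> C" for p x
        unfolding u_def using that by (intro cINF_lower bdd)
      have great: "m \<le> u x" if "\<And>p. p \<in> C \<Longrightarrow> m \<le> p x" for m x
        unfolding u_def using that False by (intro cINF_greatest) auto
      have "sublinear u"
      proof (rule sublinearI)
        fix x y
        have pq: "u (x + y) \<le> p x + q y" if pqC: "p \<in> C" "q \<in> C" for p q
        proof -
          obtain r where r: "r \<in> C" "P p r" "P q r"
            using tot[OF pqC] pqC by (meson P_def order_refl)
          have "u (x + y) \<le> r x + r y"
            using low[OF r(1), of "x + y"] sublinear_add[OF sub[OF r(1)], of x y] by simp
          also have "\<dots> \<le> p x + q y" using r by (auto simp: P_def intro: add_mono)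
          finally show ?thesis .
        qed
        have "u (x + y) - p x \<le> u y" if "p \<in> C" for p
          using pq[OF that] by (intro great) (simp add: algebra_simps)
        then have "u (x + y) - u y \<le> u x"
          by (intro great) (simp add: algebra_simps)
        then show "u (x + y) \<le> u x + u y" by simp
      next
        fix c :: real and x assume c: "0 < c"
        have "u (c *\<^sub>R x) / c \<le> u x"
        proof (rule great)
          fix p assume p: "p \<in> C"
          show "u (c *\<^sub>R x) / c \<le> p x"
            using low[OF p, of "c *\<^sub>R x"] sublinear_scaleR[OF sub[OF p], of c x] c
            by (simp add: field_simps)
        qed
        then show "u (c *\<^sub>R x) \<le> c * u x" using c by (simp add: field_simps)
      next
        have "u 0 = (INF p\<in>C. 0)"
          unfolding u_def by (intro INF_cong refl) (simp add: sub sublinear_zero)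
        then show "u 0 = 0" using False by simp
      qed
      moreover have "u x \<le> p0 x" for x
      proof -
        obtain p where "p \<in> C" using False by blast
        then have "p x \<le> p0 x" using CA by (auto simp: A_def)
        then show ?thesis using low[OF \<open>p \<in> C\<close>, of x] by simp
      qed
      ultimately show ?thesis using low by (auto simp: A_def P_def)
    qed
  qed
  then obtain p where p: "sublinear p" "\<And>x. p x \<le> p0 x"
    and min: "\<And>q. sublinear q \<Longrightarrow> (\<And>x. q x \<le> p0 x) \<Longrightarrow> (\<And>x. q x \<le> p x) \<Longrightarrow> q = p"
    by (auto simp: A_def P_def)
  have minus: "p (- y) = - p y" for y
  proof -
    obtain q where q: "sublinear q" "\<And>x. q x \<le> p x" "q (- y) \<le> - p y"
      using sublinear_lowering[OF p(1)] by metis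
    then have "q = p" using min p(2) by (meson order_trans)
    then show ?thesis using q(3) sublinear_minus[OF p(1), of y] by simp
  qed
  have "linear p"
  proof (rule linearI)
    fix x y
    show "p (x + y) = p x + p y"
      using sublinear_add[OF p(1), of x y] sublinear_add[OF p(1), of "x + y" "- y"] minus[of y]
      by simp
  next
    fix c :: real and x
    show "p (c *\<^sub>R x) = c *\<^sub>R p x"
      using sublinear_scaleR[OF p(1), of c x] sublinear_scaleR[OF p(1), of "- c" x] minus[of "c *\<^sub>R x"]
      by (cases "0 \<le> c") auto
  qed
  then show thesis using that p(2) by blast
qed

lemma bounded_functional_separating_point:
  fixes w :: "'a::real_normed_vector"
  assumes "w \<noteq> 0"
  obtains f :: "'a \<Rightarrow> real" where "bounded_linear f" "f w = 1"
proof -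
  have "sublinear (norm :: 'a \<Rightarrow> real)"
    by (auto simp: sublinear_def norm_triangle_ineq)
  then obtain q :: "'a \<Rightarrow> real" where q: "sublinear q" "\<And>x. q x \<le> norm x" "q (- w) \<le> - norm w"
    using sublinear_lowering by metis
  obtain g where g: "linear g" "\<And>x. g x \<le> q x"
    using linear_below_sublinear[OF q(1)] by metis
  have up: "g x \<le> norm x" for x using g(2) q(2) order_trans by blast
  have "\<bar>g x\<bar> \<le> norm x" for x
    using up[of x] up[of "- x"] linear_neg[OF g(1), of x] by auto
  then have "bounded_linear g"
    using g(1) by (intro bounded_linear_intro[where K = 1]) (auto simp: linear_add linear_scale)
  moreover have "norm w \<le> g w"
    using g(2)[of "- w"] q(3) linear_neg[OF g(1), of w] by simp
  then have "g w \<noteq> 0" using assms by auto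
  ultimately show thesis
    by (intro that[of "\<lambda>x. g x / g w"]) (auto intro: bounded_linear_divide bounded_linear_compose[of "\<lambda>x. x / g w"])
qed

lemma finite_span_projection:
  fixes B :: "'a::real_normed_vector set"
  assumes "finite B"
  obtains P where "bounded_linear P" "\<And>x. P (P x) = P x" "range P = span B"
proof -
  have "\<exists>P. bounded_linear P \<and> (\<forall>x. P (P x) = P x) \<and> range P = span B"
    using assms
  proof (induction B)
    case empty
    then show ?case by (intro exI[of _ "\<lambda>x. 0"]) auto
  next
    case (insert b B)
    then obtain P where P: "bounded_linear P" "\<And>x. P (P x) = P x" "range P = span B" by auto
    interpret P: bounded_linear P by fact
    have fixP: "P x = x" if "x \<in> span B" for x using that P by (metis rangeE)
    show ?case
    proof (cases "b \<in> span B")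
      case True
      then show ?thesis using P by (auto simp: span_redundant)
    next
      case False
      define w where "w = b - P b"
      have Pb: "P b \<in> span B" using P(3) by auto
      have "w \<noteq> 0" using False Pb by (auto simp: w_def)
      then obtain f :: "'a \<Rightarrow> real" where f: "bounded_linear f" "f w = 1"
        using bounded_functional_separating_point by blast
      interpret f: bounded_linear f by fact
      have Pw: "P w = 0" by (simp add: w_def P.diff P(2))
      define R where "R x = P x + f (x - P x) *\<^sub>R w" for x
      have "bounded_linear R"
        unfolding R_def using P.bounded_linear_axioms f(1)
        by (intro bounded_linear_add bounded_linear_scaleR_const
            bounded_linear_compose[OF f(1)] bounded_linear_sub bounded_linear_ident)
      moreover have "R (R x) = R x" for x
        by (simp add: R_def P.add P.scaleR P(2) Pw f.diff f.scaleR f.add f(2))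
      moreover have "range R = span (insert b B)"
      proof
        have "w \<in> span (insert b B)"
          using Pb span_mono[of B "insert b B"] unfolding w_def
          by (intro span_diff) (auto intro: span_base)
        moreover have "P x \<in> span (insert b B)" for x
          using P(3) span_mono[of B "insert b B"] by auto
        ultimately show "range R \<subseteq> span (insert b B)"
          by (auto simp: R_def intro!: span_add span_scale)
      next
        have "x \<in> range R" if x: "x \<in> span (insert b B)" for x
        proof -
          obtain k where k: "x - k *\<^sub>R b \<in> span B" using x by (auto simp: span_insert)
          have "R (x - k *\<^sub>R b) = x - k *\<^sub>R b"
            using fixP[OF k] by (simp add: R_def f.zero)
          moreover have "R b = b" by (simp add: R_def f(2) w_def[symmetric]) (simp add: w_def)
          moreover have "R (x - k *\<^sub>R b) = R x - k *\<^sub>R R b"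
            using \<open>bounded_linear R\<close> by (simp add: linear_simps)
          ultimately have "R x = x" by simp
          then show ?thesis by (metis rangeI)
        qed
        then show "span (insert b B) \<subseteq> range R" by blast
      qed
      ultimately show ?thesis by blast
    qed
  qed
  then show thesis using that by blast
qed

lemma finite_span_splitting:
  fixes B :: "'a::real_normed_vector set"
  assumes "finite B"
  obtains W where "splitting (span B) W"
proof -
  obtain P where P: "bounded_linear P" "\<And>x. P (P x) = P x" "range P = span B"
    using finite_span_projection[OF assms] by metis
  interpret P: bounded_linear P by fact
  have B: "span B = {x. P x = x}" using P(2) unfolding P(3)[symmetric] by (auto intro: range_eqI[OF sym])
  have "splitting (span B) {x. P x = 0}"
    unfolding splitting_def algebraic_complement_def
  proof (intro conjI allI)
    show "closed (span B)" unfolding B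
      by (intro closed_Collect_eq continuous_intros P.continuous_on)
    show "closed {x. P x = 0}"
      by (intro closed_Collect_eq continuous_intros P.continuous_on)
    show "subspace (span B)" by simp
    show "subspace {x. P x = 0}" by (simp add: subspace_def P.add P.scaleR P.zero)
    show "span B \<inter> {x. P x = 0} = {0}" unfolding B by (auto simp: P.zero)
    show "\<exists>v\<in>span B. \<exists>w\<in>{x. P x = 0}. x = v + w" for x
      using P(2) by (intro bexI[of _ "P x"] bexI[of _ "x - P x"]) (auto simp: P.diff B)
  qed
  then show thesis by (rule that)
qed

subsection \<open>The open mapping theorem\<close>

lemma approximate_preimage:
  fixes f :: "'a::banach \<Rightarrow> 'b::banach"
  assumes f: "bounded_linear f" and S: "subspace S" and onto: "f ` S = UNIV"
  obtains K where "K > 0" "\<And>y \<epsilon>. \<epsilon> > 0 \<Longrightarrow> \<exists>x\<in>S. norm x \<le> K * norm y \<and> norm (y - f x) \<le> \<epsilon>"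
proof -
  interpret f: bounded_linear f by fact
  define C where "C n = closure (f ` (S \<inter> cball 0 (real n)))" for n :: nat
  have "\<exists>n. interior (C n) \<noteq> {}"
  proof (rule ccontr)
    assume "\<not> ?thesis"
    then have "euclidean interior_of \<Union>(range C) = {}"
      by (intro Baire_category_alt)
        (auto simp: completely_metrizable_space_euclidean C_def)
    moreover have "\<Union>(range C) = UNIV"
    proof -
      have "y \<in> \<Union>(range C)" for y
      proof -
        obtain x where x: "x \<in> S" "f x = y" using onto by (metis UNIV_I imageE)
        obtain n :: nat where "norm x \<le> real n" using real_arch_simple by blast
        then have "y \<in> C n" using x closure_subset unfolding C_def by fastforce
        then show ?thesis by blast
      qed
      then show ?thesis by blast
    qed
    ultimately show False by simp
  qed
  then obtain n y0 r where r: "r > 0" "ball y0 r \<subseteq> C n"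
    by (metis all_not_in_conv mem_interior)
  have near: "\<exists>x\<in>S. norm x \<le> 2 * real n \<and> norm (z - f x) \<le> \<epsilon>"
    if z: "norm z < r" and "\<epsilon> > 0" for z \<epsilon>
  proof -
    have appr: "\<exists>x\<in>S. norm x \<le> real n \<and> norm (f x - v) < \<epsilon> / 2" if "v \<in> ball y0 r" for v
    proof -
      have "v \<in> closure (f ` (S \<inter> cball 0 (real n)))" using that r(2) by (auto simp: C_def)
      then show ?thesis
        using \<open>\<epsilon> > 0\<close> unfolding closure_approachable
        by (force simp: dist_norm dest: spec[of _ "\<epsilon> / 2"])
    qed
    obtain a where a: "a \<in> S" "norm a \<le> real n" "norm (f a - (y0 + z)) < \<epsilon> / 2"
      using appr[of "y0 + z"] z by (auto simp: dist_norm)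
    obtain b where b: "b \<in> S" "norm b \<le> real n" "norm (f b - y0) < \<epsilon> / 2"
      using appr[of y0] r by auto
    have eq: "z - f (a - b) = (f b - y0) - (f a - (y0 + z))" by (simp add: f.diff)
    have "norm (z - f (a - b)) \<le> \<epsilon>"
      unfolding eq using norm_triangle_ineq4[of "f b - y0" "f a - (y0 + z)"] a(3) b(3) by linarith
    moreover have "norm (a - b) \<le> 2 * real n"
      using norm_triangle_ineq4[of a b] a b by simp
    ultimately show ?thesis using subspace_diff[OF S a(1) b(1)] by blast
  qed
  show thesis
  proof
    define K where "K = 4 * real n / r + 1"
    show "K > 0" using r by (auto simp: K_def intro: add_nonneg_pos)
    fix y and \<epsilon> :: real assume "\<epsilon> > 0"
    show "\<exists>x\<in>S. norm x \<le> K * norm y \<and> norm (y - f x) \<le> \<epsilon>"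
    proof (cases "y = 0")
      case True
      then show ?thesis using \<open>\<epsilon> > 0\<close> subspace_0[OF S] by (intro bexI[of _ 0]) (auto simp: f.zero)
    next
      case False
      define c where "c = r / (2 * norm y)"
      have c: "c > 0" using r False by (simp add: c_def)
      have "norm (c *\<^sub>R y) < r" using r False by (simp add: c_def)
      then obtain x where x: "x \<in> S" "norm x \<le> 2 * real n" "norm (c *\<^sub>R y - f x) \<le> c * \<epsilon>"
        using near[of "c *\<^sub>R y" "c * \<epsilon>"] c \<open>\<epsilon> > 0\<close> by auto
      have "norm (inverse c *\<^sub>R x) \<le> inverse c * (2 * real n)"
        using x(2) c by simp
      also have "\<dots> = 4 * real n / r * norm y" using r False by (simp add: c_def field_simps)
      also have "\<dots> \<le> K * norm y" by (simp add: K_def algebra_simps)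
      finally have 1: "norm (inverse c *\<^sub>R x) \<le> K * norm y" .
      have eq: "y - f (inverse c *\<^sub>R x) = inverse c *\<^sub>R (c *\<^sub>R y - f x)"
        using c by (simp add: f.scaleR scaleR_diff_right)
      have "norm (y - f (inverse c *\<^sub>R x)) \<le> \<epsilon>"
        unfolding eq using x(3) c by (simp add: pos_divide_le_eq divide_inverse_commute[symmetric] mult.commute)
      with 1 show ?thesis using subspace_scale[OF S x(1)] by blast
    qed
  qed
qed

lemma bounded_preimage:
  fixes f :: "'a::banach \<Rightarrow> 'b::banach"
  assumes f: "bounded_linear f" and S: "subspace S" "closed S" and onto: "f ` S = UNIV"
  obtains K where "\<And>y. \<exists>x\<in>S. f x = y \<and> norm x \<le> K * norm y"
proof -
  interpret f: bounded_linear f by fact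
  obtain K where K: "K > 0"
    "\<And>y \<epsilon>. \<epsilon> > 0 \<Longrightarrow> \<exists>x\<in>S. norm x \<le> K * norm y \<and> norm (y - f x) \<le> \<epsilon>"
    using approximate_preimage[OF f S(1) onto] by metis
  have "\<exists>x\<in>S. norm x \<le> K * norm y \<and> norm (y - f x) \<le> norm y / 2" for y
    using K(2)[of "norm y / 2" y] subspace_0[OF S(1)]
    by (cases "y = 0") (auto intro!: bexI[of _ 0] simp: f.zero)
  then obtain g where g: "\<And>y. g y \<in> S" "\<And>y. norm (g y) \<le> K * norm y"
    "\<And>y. norm (y - f (g y)) \<le> norm y / 2"
    by metis
  show thesis
  proof
    fix y
    define s where "s n = ((\<lambda>z. z - f (g z)) ^^ n) y" for n
    have s0: "s 0 = y" and sS: "s (Suc n) = s n - f (g (s n))" for n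
      by (simp_all add: s_def)
    have sn: "norm (s n) \<le> norm y * (1/2) ^ n" for n
    proof (induction n)
      case (Suc n)
      then show ?case using g(3)[of "s n"] by (simp add: sS)
    qed (simp add: s0)
    have gn: "norm (g (s n)) \<le> K * norm y * (1/2) ^ n" for n
      using order_trans[OF g(2) mult_left_mono[OF sn, of K]] K(1) by (simp add: mult.assoc)
    have geo: "summable (\<lambda>n. K * norm y * (1/2) ^ n)"
      by (intro summable_mult summable_geometric) simp
    have sumg: "summable (\<lambda>n. g (s n))"
      by (rule summable_comparison_test'[OF geo, of 0]) (use gn in auto)
    define x where "x = (\<Sum>n. g (s n))"
    have "x \<in> S"
    proof (rule closed_sequentially[OF S(2)])
      show "(\<Sum>i<n. g (s i)) \<in> S" for n
        using S(1) g(1) by (intro subspace_sum) auto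
      show "(\<lambda>n. \<Sum>i<n. g (s i)) \<longlonglongrightarrow> x"
        using summable_LIMSEQ[OF sumg] by (simp add: x_def)
    qed
    moreover have "norm x \<le> (2 * K) * norm y"
    proof -
      have "norm x \<le> (\<Sum>n. K * norm y * (1/2) ^ n)"
        unfolding x_def using gn by (rule norm_suminf_le[OF _ geo])
      also have "\<dots> = (2 * K) * norm y"
        by (simp add: suminf_mult suminf_geometric summable_geometric)
      finally show ?thesis .
    qed
    moreover have "f x = y"
    proof -
      have "(\<lambda>n. f (g (s n))) sums f x"
        unfolding x_def using sumg by (intro f.sums summable_sums)
      moreover have "s \<longlonglongrightarrow> 0"
        by (rule Lim_null_comparison[of _ "\<lambda>n. norm y * (1/2) ^ n"])
          (auto simp: sn intro!: tendsto_mult_right_zero LIMSEQ_power_zero)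
      then have "(\<lambda>n. s n - s (Suc n)) sums (s 0 - 0)"
        by (rule telescope_sums')
      ultimately show ?thesis
        by (simp add: sS s0 sums_unique2)
    qed
    ultimately show "\<exists>x\<in>S. f x = y \<and> norm x \<le> (2 * K) * norm y" by blast
  qed
qed

subsection \<open>Dimension and codimension\<close>

lemma edim_enat_iff:
  assumes "subspace V"
  shows "edim V = enat m \<longleftrightarrow> (\<exists>B. finite B \<and> independent B \<and> span B = V \<and> card B = m)"
proof
  assume "edim V = enat m"
  then obtain B0 where B0: "finite B0" "V \<subseteq> span B0" and m: "dim V = m"
    by (auto simp: edim_def split: if_splits)
  obtain B where B: "B \<subseteq> V" "independent B" "V \<subseteq> span B" "card B = dim V"
    by (rule basis_exists)
  have "finite B" using independent_span_bound[OF B0(1) B(2)] B(1) B0(2) by blast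
  moreover have "span B = V" using B(1,3) assms by (simp add: span_subspace)
  ultimately show "\<exists>B. finite B \<and> independent B \<and> span B = V \<and> card B = m"
    using B m by blast
next
  assume "\<exists>B. finite B \<and> independent B \<and> span B = V \<and> card B = m"
  then obtain B where B: "finite B" "independent B" "span B = V" "card B = m" by blast
  then have "dim V = m" by (metis dim_eq_card span_span)
  then show "edim V = enat m" using B by (auto simp: edim_def)
qed

lemma edim_infinity_iff: "edim V = \<infinity> \<longleftrightarrow> \<not> (\<exists>B. finite B \<and> V \<subseteq> span B)"
  by (simp add: edim_def)

lemma edim_image:
  assumes f: "linear f" "inj f" and V: "subspace V"
  shows "edim (f ` V) = edim V"
proof (cases "edim V")
  case (enat m)
  then obtain B where B: "finite B" "independent B" "span B = V" "card B = m"
    using edim_enat_iff[OF V] by blast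
  have "edim (f ` V) = enat m"
  proof (subst edim_enat_iff[OF linear_subspace_image[OF f(1) V]], intro exI[of _ "f ` B"] conjI)
    show "independent (f ` B)"
      using linear_independent_injective_image[OF f(1) B(2)] f(2) by (simp add: inj_on_subset)
    show "span (f ` B) = f ` V" using linear_span_image[OF f(1)] B(3) by simp
    show "card (f ` B) = m" using B(4) f(2) by (simp add: card_image inj_on_subset)
  qed (simp add: B(1))
  then show ?thesis using enat by simp
next
  case infinity
  obtain g where g: "linear g" "g \<circ> f = id"
    using linear_injective_left_inverse[OF f] by blast
  have "edim (f ` V) = \<infinity>"
  proof (rule ccontr)
    assume "edim (f ` V) \<noteq> \<infinity>"
    then obtain B where B: "finite B" "f ` V \<subseteq> span B" by (auto simp: edim_infinity_iff)
    have "V = g ` f ` V" using g(2) by (simp add: image_comp)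
    also have "\<dots> \<subseteq> span (g ` B)" using B(2) linear_span_image[OF g(1)] by auto
    finally have "V \<subseteq> span (g ` B)" .
    then show False using infinity B(1) edim_infinity_iff[of V] finite_imageI by metis
  qed
  then show ?thesis using infinity by simp
qed

lemma subspace_eq_if_edim_eq:
  assumes "subspace V" "subspace W" "V \<subseteq> W" "edim V = enat m" "edim W = enat m"
  shows "V = W"
proof -
  obtain B where B: "finite B" "independent B" "span B = V" "card B = m"
    using assms edim_enat_iff by blast
  obtain C where C: "finite C" "independent C" "span C = W" "card C = m"
    using assms edim_enat_iff by blast
  have "w \<in> V" if "w \<in> W" for w
  proof (rule ccontr)
    assume w: "w \<notin> V"
    then have "independent (insert w B)" using B by (intro independent_insertI) auto
    moreover have "insert w B \<subseteq> span C" using that B C assms(3) span_superset by blast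
    ultimately have "card (insert w B) \<le> m" using independent_span_bound[OF C(1)] C(4) by blast
    moreover have "w \<notin> B" using w B(3) span_base by blast
    ultimately show False using B by simp
  qed
  then show ?thesis using assms(3) by blast
qed

text \<open>Projecting a complement of the larger space along the smaller one is injective, hence onto
  a complement of the smaller one by equality of dimensions.\<close>

lemma subspace_eq_if_codim_eq:
  assumes VW: "V \<subseteq> W" and "has_codim V (enat n)" and "has_codim W (enat n)"
  shows "V = W"
proof -
  obtain C where C: "algebraic_complement V C" "edim C = enat n"
    using assms by (auto simp: has_codim_def)
  obtain D where D: "algebraic_complement W D" "edim D = enat n"
    using assms by (auto simp: has_codim_def)

  have s: "subspace V" "subspace C" "subspace W" "subspace D" and VC: "V \<inter> C = {0}"
    and WD: "W \<inter> D = {0}"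
    using C(1) D(1) by (auto simp: algebraic_complement_def)
  have ex: "\<exists>v\<in>V. \<exists>c\<in>C. x = v + c" for x
    using C(1) by (auto simp: algebraic_complement_def)
  obtain B where B: "finite B" "independent B" "span B = C" "card B = n"
    using C(2) edim_enat_iff[OF s(2)] by blast
  obtain B' where B': "finite B'" "independent B'" "span B' = D" "card B' = n"
    using D(2) edim_enat_iff[OF s(4)] by blast
  have "\<exists>c. c \<in> C \<and> x - c \<in> V" for x
    using ex[of x] by (metis add_diff_cancel_right')
  then obtain p where p: "\<And>x. p x \<in> C" "\<And>x. x - p x \<in> V" by metis
  have uniq: "p x = c" if "c \<in> C" "x - c \<in> V" for x c
  proof -
    have "p x - c \<in> C" using p(1) that(1) s(2) by (simp add: subspace_diff)
    moreover have "p x - c = (x - c) - (x - p x)" by simp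
    then have "p x - c \<in> V" using p(2) that(2) s(1) by (metis subspace_diff)
    ultimately have "p x - c \<in> V \<inter> C" by blast
    then show ?thesis by (simp add: VC)
  qed
  have lin: "linear p"
  proof (rule linearI)
    fix x y
    have "x + y - (p x + p y) = (x - p x) + (y - p y)" by simp
    then show "p (x + y) = p x + p y"
      by (metis uniq subspace_add p s(1,2))
  next
    fix r x
    have "r *\<^sub>R x - r *\<^sub>R p x = r *\<^sub>R (x - p x)" by (simp add: scaleR_diff_right)
    then show "p (r *\<^sub>R x) = r *\<^sub>R p x"
      by (metis uniq subspace_scale p s(1,2))
  qed
  have inj: "inj_on p D"
  proof (rule linear_injective_on_subspace_0[THEN iffD2, OF lin s(4)], intro ballI impI)
    fix d assume d: "d \<in> D" "p d = 0"
    then have "d \<in> V" using p(2)[of d] by simp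
    then show "d = 0" using VW WD d by auto
  qed
  have "edim (p ` D) = enat n"
  proof (subst edim_enat_iff[OF linear_subspace_image[OF lin s(4)]], intro exI[of _ "p ` B'"] conjI)
    show "independent (p ` B')"
      using linear_independent_injective_image[OF lin B'(2)] inj B'(3) by simp
    show "span (p ` B') = p ` D" using linear_span_image[OF lin] B'(3) by simp
    show "card (p ` B') = n"
      using B'(3,4) inj by (metis card_image inj_on_subset span_superset)
  qed (simp add: B'(1))
  then have pD: "p ` D = C"
    using subspace_eq_if_edim_eq[OF linear_subspace_image[OF lin s(4)] s(2)] p(1) C(2) by blast
  have "w \<in> V" if w: "w \<in> W" for w
  proof -
    obtain d where d: "d \<in> D" "p d = p w" using pD p(1)[of w] by (metis imageE)
    then have "w - d = (w - p w) - (d - p d)" by simp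
    then have wd: "w - d \<in> V" using p(2) s(1) by (metis subspace_diff)
    then have "w - (w - d) \<in> W" using VW w s(3) by (blast intro: subspace_diff)
    then have "d = 0" using WD d(1) by auto
    then show ?thesis using wd by simp
  qed
  then show ?thesis using VW by blast
qed

lemma algebraic_complement_image:
  assumes f: "linear f" "bij f" and VW: "algebraic_complement V W"
  shows "algebraic_complement (f ` V) (f ` W)"
  unfolding algebraic_complement_def
proof (intro conjI allI)
  show "subspace (f ` V)" "subspace (f ` W)"
    using VW f(1) by (auto simp: algebraic_complement_def intro: linear_subspace_image)
  have "f ` V \<inter> f ` W = f ` (V \<inter> W)"
    using f(2) by (simp add: bij_def image_Int)
  then show "f ` V \<inter> f ` W = {0}"
    using VW f(1) by (simp add: algebraic_complement_def linear_0)
  fix y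
  obtain x where "y = f x" using f(2) by (metis bij_pointE)
  moreover obtain v w where "v \<in> V" "w \<in> W" "x = v + w"
    using VW unfolding algebraic_complement_def by blast
  ultimately show "\<exists>v\<in>f ` V. \<exists>w\<in>f ` W. y = v + w"
    using f(1) by (auto simp: linear_add)
qed

lemma has_codim_image:
  assumes f: "linear f" "bij f" and V: "has_codim V d"
  shows "has_codim (f ` V) d"
proof -
  obtain W where W: "algebraic_complement V W" "edim W = d"
    using V by (auto simp: has_codim_def)
  have "edim (f ` W) = d"
    using edim_image[OF f(1)] f(2) W by (simp add: bij_is_inj algebraic_complement_def)
  then show ?thesis
    using algebraic_complement_image[OF f W(1)] unfolding has_codim_def by blast
qed

subsection \<open>Equivalence of operators\<close>

definition blinfun_inverses :: "('a::real_normed_vector \<Rightarrow>\<^sub>L 'b::real_normed_vector) \<Rightarrow> ('b \<Rightarrow>\<^sub>L 'a) \<Rightarrow> bool" where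
  "blinfun_inverses G H \<longleftrightarrow> G o\<^sub>L H = id_blinfun \<and> H o\<^sub>L G = id_blinfun"

lemma blinfun_inverses_apply:
  assumes "blinfun_inverses G H"
  shows "G (H x) = x" and "H (G y) = y"
  using assms unfolding blinfun_inverses_def
  by (metis blinfun_apply_blinfun_compose blinfun_apply_id_blinfun)+

lemma blinfun_inverses_sym: "blinfun_inverses G H \<Longrightarrow> blinfun_inverses H G"
  by (auto simp: blinfun_inverses_def)

lemma blinfun_linear: "linear (blinfun_apply G)"
  by (simp add: blinfun.bounded_linear_right bounded_linear.linear)

lemma blinfun_inverses_bij: "blinfun_inverses G H \<Longrightarrow> bij (blinfun_apply G)"
  by (intro bijI') (metis blinfun_inverses_apply)+

lemma blinfun_inverses_image_eq:
  "blinfun_inverses G H \<Longrightarrow> blinfun_apply G ` V = blinfun_apply H -` V"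
  by (force simp: image_iff blinfun_inverses_apply)

lemma blinfun_inverses_closed_image:
  "blinfun_inverses G H \<Longrightarrow> closed V \<Longrightarrow> closed (blinfun_apply G ` V)"
  by (simp add: blinfun_inverses_image_eq continuous_closed_vimage blinfun.bounded_linear_right
      linear_continuous_at)

lemma splitting_image:
  assumes "blinfun_inverses G H" "splitting V W"
  shows "splitting (blinfun_apply G ` V) (blinfun_apply G ` W)"
  using assms unfolding splitting_def
  by (auto intro: blinfun_inverses_closed_image algebraic_complement_image blinfun_linear
      blinfun_inverses_bij)

lemma null_space_subspace: "subspace (null_space T)"
  by (simp add: null_space_def subspace_def blinfun.bilinear_simps)

lemma range_space_subspace: "subspace (range_space T)"
  unfolding range_space_def by (simp add: blinfun_linear linear_subspace_image)

context
  fixes G G' :: "'b::banach \<Rightarrow>\<^sub>L 'b" and H H' :: "'a::banach \<Rightarrow>\<^sub>L 'a" and T :: "'a \<Rightarrow>\<^sub>L 'b"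
  assumes G: "blinfun_inverses G G'" and H: "blinfun_inverses H H'"
begin

lemma null_space_equivalent: "null_space (G o\<^sub>L T o\<^sub>L H) = blinfun_apply H' ` null_space T"
proof -
  have "G y = 0 \<longleftrightarrow> y = 0" for y
    using blinfun_inverses_apply[OF G] by (metis blinfun.zero_right)
  then show ?thesis
    unfolding blinfun_inverses_image_eq[OF blinfun_inverses_sym[OF H]] null_space_def by auto
qed

lemma range_space_equivalent: "range_space (G o\<^sub>L T o\<^sub>L H) = blinfun_apply G ` range_space T"
proof -
  have "surj (blinfun_apply H)" using blinfun_inverses_bij[OF H] by (rule bij_is_surj)
  then have "range (blinfun_apply T) = (\<lambda>x. T (H x)) ` UNIV"
    by (simp only: image_image[symmetric])
  then show ?thesis unfolding range_space_def by (simp add: image_image)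
qed

lemma edim_null_space_equivalent: "edim (null_space (G o\<^sub>L T o\<^sub>L H)) = edim (null_space T)"
  unfolding null_space_equivalent
  using blinfun_inverses_bij[OF blinfun_inverses_sym[OF H]]
  by (simp add: edim_image blinfun_linear bij_is_inj null_space_subspace)

lemma edim_range_space_equivalent: "edim (range_space (G o\<^sub>L T o\<^sub>L H)) = edim (range_space T)"
  unfolding range_space_equivalent using blinfun_inverses_bij[OF G]
  by (simp add: edim_image blinfun_linear bij_is_inj range_space_subspace)

lemma has_codim_range_space_equivalent:
  "has_codim (range_space T) d \<Longrightarrow> has_codim (range_space (G o\<^sub>L T o\<^sub>L H)) d"
  unfolding range_space_equivalent
  by (intro has_codim_image blinfun_linear blinfun_inverses_bij[OF G])

lemma double_splitting_equivalent:
  "double_splitting T \<Longrightarrow> double_splitting (G o\<^sub>L T o\<^sub>L H)"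
  unfolding double_splitting_def null_space_equivalent range_space_equivalent
  using blinfun_inverses_closed_image[OF G] splitting_image[OF G]
    splitting_image[OF blinfun_inverses_sym[OF H]] by blast

end

definition operator_class :: "nat \<Rightarrow> nat \<Rightarrow> nat \<Rightarrow> ('a::banach \<Rightarrow>\<^sub>L 'b::banach) set \<Rightarrow> bool" where
  "operator_class k m n S \<longleftrightarrow> S \<in> {rank_set k, Phi_fin_fin m n, Phi_fin_inf m, Phi_inf_fin n}"

lemma operator_class_equivalent:
  assumes "operator_class k m n S" "T \<in> S" "blinfun_inverses G G'" "blinfun_inverses H H'"
  shows "G o\<^sub>L T o\<^sub>L H \<in> S"
proof -
  note eq = edim_null_space_equivalent[OF assms(3,4)] edim_range_space_equivalent[OF assms(3,4)]
  note imp = has_codim_range_space_equivalent[OF assms(3,4), of T]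
    double_splitting_equivalent[OF assms(3,4), of T]
  consider "S = rank_set k" | "S = Phi_fin_fin m n" | "S = Phi_fin_inf m" | "S = Phi_inf_fin n"
    using assms(1) by (auto simp: operator_class_def)
  then show ?thesis
    using assms(2) imp
    by cases (simp_all add: rank_set_def Phi_fin_fin_def Phi_fin_inf_def Phi_inf_fin_def
      fredholm_def semi_fredholm_def eq, blast+)
qed

lemma operator_class_null_or_range_eq:
  assumes "operator_class k m n S" "X \<in> S" "Y \<in> S"
    and "null_space Y \<subseteq> null_space X" "range_space X \<subseteq> range_space Y"
  shows "null_space Y = null_space X \<or> range_space X = range_space Y"
proof -
  note eq = subspace_eq_if_edim_eq[OF null_space_subspace null_space_subspace assms(4), of m]
    subspace_eq_if_edim_eq[OF range_space_subspace range_space_subspace assms(5), of k]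
    subspace_eq_if_codim_eq[OF assms(5), of n]
  consider "S = rank_set k" | "S = Phi_fin_fin m n" | "S = Phi_fin_inf m" | "S = Phi_inf_fin n"
    using assms(1) by (auto simp: operator_class_def)
  then show ?thesis
    using assms(2,3) eq
    by cases (simp_all add: rank_set_def Phi_fin_fin_def Phi_fin_inf_def Phi_inf_fin_def)
qed

subsection \<open>Generalized inverses\<close>

text \<open>The map \<open>E\<^sub>0 \<times> C \<rightarrow> F\<close>, \<open>(e, c) \<mapsto> X e + c\<close>, is a continuous bijection; the first component of its
  inverse is the generalized inverse of \<open>X\<close>.\<close>

lemma generalized_inverse_exists:
  fixes X :: "'a::banach \<Rightarrow>\<^sub>L 'b::banach"
  assumes E: "algebraic_complement (null_space X) E" "closed E"
    and C: "algebraic_complement (range_space X) C" "closed C"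
  obtains A where "X o\<^sub>L A o\<^sub>L X = X" "A o\<^sub>L X o\<^sub>L A = A"
proof -
  have s: "subspace E" "subspace C" and NE: "null_space X \<inter> E = {0}"
    and RC: "range_space X \<inter> C = {0}"
    using assms by (auto simp: algebraic_complement_def)
  define f where "f p = X (fst p) + snd p" for p :: "'a \<times> 'b"
  have f: "bounded_linear f" unfolding f_def
    by (intro bounded_linear_add bounded_linear_snd bounded_linear_compose[OF _ bounded_linear_fst]
        blinfun.bounded_linear_right)
  have decomp: "\<exists>e\<in>E. X e = X x" for x
  proof -
    obtain z e where "z \<in> null_space X" "e \<in> E" "x = z + e"
      using E(1) unfolding algebraic_complement_def by blast
    then show ?thesis by (auto simp: null_space_def blinfun.add_right)
  qed
  have onto: "f ` (E \<times> C) = UNIV"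
  proof -
    have "y \<in> f ` (E \<times> C)" for y
    proof -
      obtain x c where c: "c \<in> C" "y = X x + c"
        using C(1) unfolding algebraic_complement_def range_space_def by blast
      obtain e where "e \<in> E" "X e = X x" using decomp by blast
      then show ?thesis using c by (intro image_eqI[of _ _ "(e, c)"]) (auto simp: f_def)
    qed
    then show ?thesis by blast
  qed
  obtain K where K: "\<And>y. \<exists>p\<in>E \<times> C. f p = y \<and> norm p \<le> K * norm y"
    using bounded_preimage[OF f subspace_Times[OF s] closed_Times[OF E(2) C(2)] onto] by metis
  have uniq: "e = e'" if ec: "e \<in> E" "c \<in> C" "e' \<in> E" "c' \<in> C" "X e + c = X e' + c'" for e c e' c'
  proof -
    have "X (e - e') = c' - c" using ec(5) by (simp add: blinfun.diff_right algebra_simps)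
    then have "X (e - e') \<in> C"
      using ec s(2) by (simp add: subspace_diff)
    then have "X (e - e') \<in> range_space X \<inter> C"
      unfolding range_space_def by blast
    then have "e - e' \<in> null_space X \<inter> E"
      using RC ec s(1) by (auto simp: null_space_def subspace_diff)
    then show ?thesis using NE by simp
  qed
  have "\<exists>e. e \<in> E \<and> (\<exists>c\<in>C. y = X e + c) \<and> norm e \<le> K * norm y" for y
  proof -
    obtain e c where "e \<in> E" "c \<in> C" "f (e, c) = y" "norm (e, c) \<le> K * norm y"
      using K[of y] by auto
    then show ?thesis using norm_fst_le[of e c] by (auto simp: f_def)
  qed
  then obtain a where a: "\<And>y. a y \<in> E" "\<And>y. \<exists>c\<in>C. y = X (a y) + c" "\<And>y. norm (a y) \<le> K * norm y"
    by metis
  have aeq: "a y = e" if "e \<in> E" "c \<in> C" "y = X e + c" for y e c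
    using a(1,2) uniq that by metis
  have "bounded_linear a"
  proof (rule bounded_linear_intro[where K = K])
    fix x y
    obtain c d where cd: "c \<in> C" "d \<in> C" "x = X (a x) + c" "y = X (a y) + d" using a(2) by metis
    have "x + y = X (a x + a y) + (c + d)"
      using arg_cong2[OF cd(3,4), of "(+)"] by (simp add: blinfun.add_right ac_simps)
    then show "a (x + y) = a x + a y"
      using s a(1) cd(1,2) by (intro aeq[where c = "c + d"]) (auto simp: subspace_add)
  next
    fix r x
    obtain c where c: "c \<in> C" "x = X (a x) + c" using a(2) by metis
    have "r *\<^sub>R x = X (r *\<^sub>R a x) + r *\<^sub>R c"
      using arg_cong[OF c(2), of "scaleR r"] by (simp add: blinfun.scaleR_right scaleR_add_right)
    then show "a (r *\<^sub>R x) = r *\<^sub>R a x"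
      using s a(1) c(1) by (intro aeq[where c = "r *\<^sub>R c"]) (auto simp: subspace_scale)
  next
    show "norm (a x) \<le> norm x * K" for x using a(3)[of x] by (simp add: mult.commute)
  qed
  define A where "A = Blinfun a"
  have A: "blinfun_apply A = a" unfolding A_def by (rule bounded_linear_Blinfun_apply) fact
  have "X (a (X x)) = X x" for x
  proof -
    obtain e where "e \<in> E" "X e = X x" using decomp by blast
    then have "a (X x) = e" using subspace_0[OF s(2)] by (intro aeq[where c = 0]) auto
    then show ?thesis using \<open>X e = X x\<close> by simp
  qed
  moreover have "a (X (a y)) = a y" for y
    using a(1) subspace_0[OF s(2)] by (intro aeq[where c = 0]) auto
  ultimately show thesis
    by (intro that[of A] blinfun_eqI) (simp_all add: A)
qed

lemma finite_edim_splitting: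
  fixes V :: "'a::real_normed_vector set"
  assumes "subspace V" "edim V = enat m"
  obtains W where "splitting V W"
  using assms edim_enat_iff[OF assms(1)] finite_span_splitting by metis

lemma finite_edim_closed:
  fixes V :: "'a::real_normed_vector set"
  assumes "subspace V" "edim V = enat m"
  shows "closed V"
  using finite_edim_splitting[OF assms] by (auto simp: splitting_def)

lemma finite_codim_complement:
  fixes V :: "'a::real_normed_vector set"
  assumes "has_codim V (enat n)"
  obtains W where "algebraic_complement V W" "closed W"
  using assms finite_edim_closed unfolding has_codim_def algebraic_complement_def by blast

lemma finite_rank_null_space_complement:
  fixes X :: "'a::banach \<Rightarrow>\<^sub>L 'b::banach"
  assumes "edim (range_space X) = enat k"
  obtains E where "algebraic_complement (null_space X) E" "closed E"
proof -
  obtain g where g: "linear g" "\<And>y. y \<in> range_space X \<Longrightarrow> X (g y) = y"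
    using linear_exists_right_inverse_on[OF blinfun_linear subspace_UNIV, of X]
    unfolding range_space_def by blast
  obtain B where B: "finite B" "span B = range_space X"
    using assms edim_enat_iff[OF range_space_subspace] by metis
  have gB: "g ` range_space X = span (g ` B)" using linear_span_image[OF g(1), of B] B(2) by simp
  have "closed (g ` range_space X)"
    unfolding gB using finite_span_splitting[of "g ` B"] B(1)
    by (metis finite_imageI splitting_def)
  moreover have "algebraic_complement (null_space X) (g ` range_space X)"
    unfolding algebraic_complement_def
  proof (intro conjI allI)
    show "null_space X \<inter> g ` range_space X = {0}"
      using g linear_0[OF g(1)] null_space_subspace[of X] range_space_subspace[of X]
      by (auto simp: null_space_def subspace_0 intro!: image_eqI[of 0 g 0])
    fix x
    have "x - g (X x) \<in> null_space X"
      by (simp add: null_space_def blinfun.diff_right g(2) range_space_def)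
    then show "\<exists>v\<in>null_space X. \<exists>w\<in>g ` range_space X. x = v + w"
      by (intro bexI[of _ "x - g (X x)"] bexI[of _ "g (X x)"]) (auto simp: range_space_def)
  qed (simp_all add: null_space_subspace gB)
  ultimately show thesis by (rule that[rotated])
qed

lemma operator_class_generalized_inverse:
  assumes S: "operator_class k m n S" "X \<in> S"
  obtains A where "X o\<^sub>L A o\<^sub>L X = X" "A o\<^sub>L X o\<^sub>L A = A"
proof -
  consider "edim (range_space X) = enat k"
    | "edim (null_space X) = enat m" "has_codim (range_space X) (enat n)" | "double_splitting X"
    using S unfolding operator_class_def rank_set_def Phi_fin_fin_def Phi_fin_inf_def
      Phi_inf_fin_def semi_fredholm_def by blast
  then obtain E C where "algebraic_complement (null_space X) E" "closed E"
    "algebraic_complement (range_space X) C" "closed C"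
  proof cases
    case 1
    then show ?thesis
      using finite_rank_null_space_complement[OF 1] finite_edim_splitting[OF range_space_subspace 1]
        that by (metis splitting_def)
  next
    case 2
    then show ?thesis
      using finite_edim_splitting[OF null_space_subspace 2(1)] finite_codim_complement[OF 2(2)] that
      by (metis splitting_def)
  next
    case 3
    then show ?thesis using that by (auto simp: double_splitting_def splitting_def)
  qed
  then show thesis using generalized_inverse_exists that by metis
qed

subsection \<open>Jets of smooth maps\<close>

text \<open>Unlike the uniform Frechet condition in the definition of smoothness, the three conditions
  below are visibly inherited by products.\<close>

definition smooth_jet ::
  "'a::real_normed_vector set \<Rightarrow> nat \<Rightarrow> ('a \<Rightarrow> 'a list \<Rightarrow> 'b::real_normed_vector) \<Rightarrow> bool" where
  "smooth_jet U n D \<longleftrightarrow> (\<forall>x\<in>U.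
     (\<forall>us ws. length us + length ws + 1 = n \<longrightarrow> linear (\<lambda>v. D x (us @ v # ws))) \<and>
     (\<forall>vs. length vs = n \<longrightarrow> ((\<lambda>y. D y vs) has_derivative (\<lambda>v. D x (v # vs))) (at x)) \<and>
     (\<exists>K\<ge>0. \<forall>\<^sub>F y in nhds x. \<forall>vs. length vs = n \<longrightarrow> norm (D y vs) \<le> K * prod_list (map norm vs)))"

definition has_smooth_jet ::
  "'a::real_normed_vector set \<Rightarrow> ('a \<Rightarrow> 'b::real_normed_vector) \<Rightarrow> bool" where
  "has_smooth_jet U f \<longleftrightarrow> (\<exists>D. (\<forall>x\<in>U. D x [] = f x) \<and> (\<forall>n. smooth_jet U n D))"

lemma smooth_jet_linear:
  "smooth_jet U n D \<Longrightarrow> x \<in> U \<Longrightarrow> length us + length ws + 1 = n \<Longrightarrow> linear (\<lambda>v. D x (us @ v # ws))"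
  unfolding smooth_jet_def by blast

lemma smooth_jet_has_derivative:
  "smooth_jet U n D \<Longrightarrow> x \<in> U \<Longrightarrow> length vs = n \<Longrightarrow>
    ((\<lambda>y. D y vs) has_derivative (\<lambda>v. D x (v # vs))) (at x)"
  unfolding smooth_jet_def by blast

lemma smooth_jet_bound:
  assumes "smooth_jet U n D" "x \<in> U"
  obtains K where "K \<ge> 0"
    "\<forall>\<^sub>F y in nhds x. \<forall>vs. length vs = n \<longrightarrow> norm (D y vs) \<le> K * prod_list (map norm vs)"
  using assms unfolding smooth_jet_def by blast

lemma prod_list_norm_nonneg: "0 \<le> prod_list (map norm vs)"
  by (induction vs) auto

lemma smooth_jet_bound_upto:
  assumes "\<And>i. i \<le> n \<Longrightarrow> smooth_jet U i D" "x \<in> U"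
  shows "\<exists>K\<ge>0. \<forall>\<^sub>F y in nhds x. \<forall>vs. length vs \<le> n \<longrightarrow> norm (D y vs) \<le> K * prod_list (map norm vs)"
  using assms(1)
proof (induction n)
  case 0
  then show ?case using smooth_jet_bound[OF 0[of 0] assms(2)] by auto
next
  case (Suc n)
  obtain K where K: "K \<ge> 0" "\<forall>\<^sub>F y in nhds x. \<forall>vs. length vs \<le> n \<longrightarrow> norm (D y vs) \<le> K * prod_list (map norm vs)"
    using Suc by auto
  obtain L where L: "L \<ge> 0" "\<forall>\<^sub>F y in nhds x. \<forall>vs. length vs = Suc n \<longrightarrow> norm (D y vs) \<le> L * prod_list (map norm vs)"
    using smooth_jet_bound[OF Suc.prems[OF order_refl] assms(2)] by blast
  have "\<forall>\<^sub>F y in nhds x. \<forall>vs. length vs \<le> Suc n \<longrightarrow> norm (D y vs) \<le> max K L * prod_list (map norm vs)"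
    using K(2) L(2)
  proof eventually_elim
    case (elim y)
    show ?case
    proof (intro allI impI)
      fix vs :: "'a list" assume "length vs \<le> Suc n"
      then have "norm (D y vs) \<le> K * prod_list (map norm vs) \<or> norm (D y vs) \<le> L * prod_list (map norm vs)"
        using elim by (auto simp: le_Suc_eq)
      moreover have "K * prod_list (map norm vs) \<le> max K L * prod_list (map norm vs)"
        "L * prod_list (map norm vs) \<le> max K L * prod_list (map norm vs)"
        by (intro mult_right_mono prod_list_norm_nonneg; simp)+
      ultimately show "norm (D y vs) \<le> max K L * prod_list (map norm vs)" by linarith
    qed
  qed
  then show ?case using K(1) by (intro exI[of _ "max K L"]) auto
qed

lemma smooth_jet_taylor:
  assumes jet: "\<And>n. smooth_jet U n D" and S: "cball x (dist x y) \<subseteq> U" and vs: "length vs = n"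
    and K: "\<And>z ws. z \<in> cball x (dist x y) \<Longrightarrow> length ws = n + 2 \<Longrightarrow>
      norm (D z ws) \<le> K * prod_list (map norm ws)" "K \<ge> 0"
  shows "norm (D y vs - D x vs - D x ((y - x) # vs)) \<le>
    norm (y - x) * (K * prod_list (map norm vs) * norm (y - x))"
proof -
  define S' where "S' = cball x (dist x y)"
  define p where "p = prod_list (map norm vs)"
  have p: "0 \<le> p" by (simp add: p_def prod_list_norm_nonneg)
  have xS: "x \<in> S'" by (simp add: S'_def)
  have second: "norm (D z (v # vs) - D x (v # vs)) \<le> (K * p * norm (y - x)) * norm v"
    if z: "z \<in> S'" for z v
  proof -
    have 1: "((\<lambda>u. D u (v # vs)) has_derivative (\<lambda>w. D u (w # v # vs))) (at u within S')"
      if "u \<in> S'" for u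
    proof -
      have "u \<in> U" using S that by (auto simp: S'_def)
      then show ?thesis
        using smooth_jet_has_derivative[OF jet[of "Suc n"], of u "v # vs"] vs
        by (simp add: has_derivative_at_withinI)
    qed
    have 2: "onorm (\<lambda>w. D u (w # v # vs)) \<le> K * p * norm v" if "u \<in> S'" for u
    proof (rule onorm_bound)
      show "0 \<le> K * p * norm v" using K(2) p by simp
      show "norm (D u (w # v # vs)) \<le> K * p * norm v * norm w" for w
        using K(1)[of u "w # v # vs"] that vs by (simp add: S'_def p_def mult.assoc mult.left_commute mult.commute)
    qed
    have "convex S'" by (simp add: S'_def)
    from differentiable_bound[OF this 1 2 z xS]
    have "norm (D z (v # vs) - D x (v # vs)) \<le> (K * p * norm v) * norm (z - x)" .
    also have "\<dots> \<le> (K * p * norm v) * norm (y - x)"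
      using z K(2) p by (intro mult_left_mono) (simp_all add: S'_def dist_norm norm_minus_commute)
    finally show ?thesis by (simp add: mult.assoc mult.left_commute mult.commute)
  qed
  have seg: "x + t *\<^sub>R (y - x) \<in> S'" if "t \<in> {0..1}" for t
    using that by (simp add: S'_def dist_norm norm_minus_commute mult_left_le_one_le)
  have first: "((\<lambda>z. D z vs) has_derivative (\<lambda>v. D z (v # vs))) (at z within S')" if "z \<in> S'" for z
  proof -
    have "z \<in> U" using S that by (auto simp: S'_def)
    then show ?thesis
      using smooth_jet_has_derivative[OF jet _ vs] by (simp add: has_derivative_at_withinI)
  qed
  have "onorm ((\<lambda>v. D z (v # vs)) - (\<lambda>v. D x (v # vs))) \<le> K * p * norm (y - x)"
    if "z \<in> S'" for z
    using second[OF that] K(2) p by (intro onorm_bound) simp_all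
  from differentiable_bound_linearization[OF seg first this xS]
  show ?thesis by (simp add: p_def)
qed

lemma smooth_map_on_if_has_smooth_jet:
  assumes U: "open U" and f: "has_smooth_jet U f"
  shows "smooth_map_on U f"
proof -
  obtain D where D: "\<And>x. x \<in> U \<Longrightarrow> D x [] = f x" "\<And>n. smooth_jet U n D"
    using f by (auto simp: has_smooth_jet_def)
  have "bounded_multilinear n (D x)" if x: "x \<in> U" for n x
  proof -
    obtain K where K: "K \<ge> 0"
      "\<forall>\<^sub>F y in nhds x. \<forall>vs. length vs = n \<longrightarrow> norm (D y vs) \<le> K * prod_list (map norm vs)"
      by (rule smooth_jet_bound[OF D(2) x])
    have "\<forall>vs. length vs = n \<longrightarrow> norm (D x vs) \<le> K * prod_list (map norm vs)"
      using eventually_nhds_x_imp_x[OF K(2)] .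
    moreover have "\<forall>us vs. length us + length vs + 1 = n \<longrightarrow> linear (\<lambda>v. D x (us @ v # vs))"
      by (intro allI impI) (rule smooth_jet_linear[OF D(2) x])
    ultimately show ?thesis unfolding bounded_multilinear_def by (intro conjI exI[of _ K])
  qed
  moreover have "\<exists>\<delta>>0. \<forall>y\<in>U. norm (y - x) < \<delta> \<longrightarrow> (\<forall>vs. length vs = n \<longrightarrow>
      norm (D y vs - D x vs - D x ((y - x) # vs)) \<le> \<epsilon> * norm (y - x) * prod_list (map norm vs))"
    if x: "x \<in> U" and e: "\<epsilon> > 0" for n x \<epsilon>
  proof -
    obtain K where K: "K \<ge> 0"
      "\<forall>\<^sub>F y in nhds x. \<forall>vs. length vs = n + 2 \<longrightarrow> norm (D y vs) \<le> K * prod_list (map norm vs)"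
      by (rule smooth_jet_bound[OF D(2) x])
    have "\<forall>\<^sub>F y in nhds x. y \<in> U" using U x by (rule eventually_nhds_in_open)
    with K(2) have "\<forall>\<^sub>F y in nhds x. y \<in> U \<and>
      (\<forall>vs. length vs = n + 2 \<longrightarrow> norm (D y vs) \<le> K * prod_list (map norm vs))"
      by (simp add: eventually_conj_iff)
    then obtain r where r: "r > 0" "\<And>y. dist y x < r \<Longrightarrow> y \<in> U \<and>
      (\<forall>vs. length vs = n + 2 \<longrightarrow> norm (D y vs) \<le> K * prod_list (map norm vs))"
      unfolding eventually_nhds_metric by blast
    define \<delta> where "\<delta> = min r (\<epsilon> / (K + 1))"
    have "\<delta> > 0" using r(1) e K(1) by (simp add: \<delta>_def)
    moreover have "norm (D y vs - D x vs - D x ((y - x) # vs)) \<le> \<epsilon> * norm (y - x) * prod_list (map norm vs)"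
      if y: "norm (y - x) < \<delta>" and vs: "length vs = n" for y vs
    proof -
      have near: "dist z x < r" if "z \<in> cball x (dist x y)" for z
        using that y by (auto simp: \<delta>_def dist_commute dist_norm norm_minus_commute)
      have "norm (D y vs - D x vs - D x ((y - x) # vs)) \<le>
        norm (y - x) * (K * prod_list (map norm vs) * norm (y - x))"
        using near r(2) K(1) by (intro smooth_jet_taylor[OF D(2) _ vs]) auto
      also have "\<dots> = (K * norm (y - x)) * (norm (y - x) * prod_list (map norm vs))" by simp
      also have "\<dots> \<le> \<epsilon> * (norm (y - x) * prod_list (map norm vs))"
      proof (intro mult_right_mono mult_nonneg_nonneg prod_list_norm_nonneg)
        have "K * norm (y - x) \<le> (K + 1) * norm (y - x)" by (simp add: algebra_simps)
        also have "\<dots> \<le> \<epsilon>" using y K(1) by (simp add: \<delta>_def field_simps)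
        finally show "K * norm (y - x) \<le> \<epsilon>" .
      qed simp
      finally show ?thesis by (simp add: mult.assoc)
    qed
    ultimately show ?thesis by blast
  qed
  ultimately show ?thesis unfolding smooth_map_on_def using D(1)
    by (intro exI[of _ "\<lambda>_. D"] conjI ballI allI impI) (simp_all only:)
qed

lemma has_smooth_jet_affine:
  assumes L: "bounded_linear L"
  shows "has_smooth_jet U (\<lambda>x. L x + c)"
proof -
  interpret L: bounded_linear L by fact
  define D where "D x vs = (case vs of [] \<Rightarrow> L x + c | [v] \<Rightarrow> L v | _ \<Rightarrow> 0)" for x vs
  have [simp]: "D x [] = L x + c" "D x [v] = L v" "D x (v # w # vs) = 0" for x v w vs
    by (simp_all add: D_def)
  have "smooth_jet U n D" for n
    unfolding smooth_jet_def
  proof (intro ballI conjI allI impI)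
    fix x and us ws :: "'a list" assume "length us + length ws + 1 = n"
    show "linear (\<lambda>v. D x (us @ v # ws))"
    proof (cases "us = [] \<and> ws = []")
      case True
      then show ?thesis by (simp add: L.linear)
    next
      case False
      then have "D x (us @ v # ws) = 0" for v
        by (cases us; cases ws; cases "tl us") (auto simp: D_def split: list.split)
      then show ?thesis by (simp add: linear_zero)
    qed
  next
    fix x and vs :: "'a list" assume "length vs = n"
    show "((\<lambda>y. D y vs) has_derivative (\<lambda>v. D x (v # vs))) (at x)"
      by (cases vs; cases "tl vs") (auto simp: D_def intro!: derivative_eq_intros L.has_derivative)
  next
    fix x
    obtain K where K: "K > 0" "\<And>v. norm (L v) \<le> norm v * K" using L.pos_bounded by blast
    have ev: "\<forall>\<^sub>F y in nhds x. norm (L y + c) < norm (L x + c) + 1"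
    proof (rule order_tendstoD(2))
      show "((\<lambda>y. norm (L y + c)) \<longlongrightarrow> norm (L x + c)) (nhds x)"
        by (intro tendsto_intros L.tendsto filterlim_ident)
    qed simp
    show "\<exists>K\<ge>0. \<forall>\<^sub>F y in nhds x. \<forall>vs. length vs = n \<longrightarrow> norm (D y vs) \<le> K * prod_list (map norm vs)"
    proof (cases n)
      case 0
      then show ?thesis
        using ev by (intro exI[of _ "norm (L x + c) + 1"]) (auto elim: eventually_mono)
    next
      case (Suc k)
      have "norm (D y vs) \<le> K * prod_list (map norm vs)" if "length vs = n" for y vs
        using that Suc K prod_list_norm_nonneg
        by (cases vs; cases "tl vs") (auto simp: D_def mult.commute intro!: mult_nonneg_nonneg)
      then show ?thesis using K by (intro exI[of _ K]) auto
    qed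
  qed
  then show ?thesis unfolding has_smooth_jet_def by (intro exI[of _ D]) simp
qed

lemma has_smooth_jet_add:
  assumes "has_smooth_jet U f" "has_smooth_jet U g"
  shows "has_smooth_jet U (\<lambda>x. f x + g x)"
proof -
  obtain D E where D: "\<And>x. x \<in> U \<Longrightarrow> D x [] = f x" "\<And>n. smooth_jet U n D"
    and E: "\<And>x. x \<in> U \<Longrightarrow> E x [] = g x" "\<And>n. smooth_jet U n E"
    using assms unfolding has_smooth_jet_def by metis
  have "smooth_jet U n (\<lambda>x vs. D x vs + E x vs)" for n
    unfolding smooth_jet_def
  proof (intro ballI conjI allI impI)
    fix x assume x: "x \<in> U"
    show "linear (\<lambda>v. D x (us @ v # ws) + E x (us @ v # ws))" if "length us + length ws + 1 = n" for us ws
      using smooth_jet_linear[OF D(2) x that] smooth_jet_linear[OF E(2) x that]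
      by (rule linear_compose_add)
    show "((\<lambda>y. D y vs + E y vs) has_derivative (\<lambda>v. D x (v # vs) + E x (v # vs))) (at x)"
      if "length vs = n" for vs
      using smooth_jet_has_derivative[OF D(2) x that] smooth_jet_has_derivative[OF E(2) x that]
      by (rule has_derivative_add)
    obtain K where K: "K \<ge> 0"
      "\<forall>\<^sub>F y in nhds x. \<forall>vs. length vs = n \<longrightarrow> norm (D y vs) \<le> K * prod_list (map norm vs)"
      by (rule smooth_jet_bound[OF D(2) x])
    obtain L where L: "L \<ge> 0"
      "\<forall>\<^sub>F y in nhds x. \<forall>vs. length vs = n \<longrightarrow> norm (E y vs) \<le> L * prod_list (map norm vs)"
      by (rule smooth_jet_bound[OF E(2) x])
    have "\<forall>\<^sub>F y in nhds x. \<forall>vs. length vs = n \<longrightarrow>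
      norm (D y vs + E y vs) \<le> (K + L) * prod_list (map norm vs)"
      using K(2) L(2)
      by eventually_elim (auto simp: distrib_right intro!: norm_triangle_mono)
    then show "\<exists>K\<ge>0. \<forall>\<^sub>F y in nhds x. \<forall>vs. length vs = n \<longrightarrow>
      norm (D y vs + E y vs) \<le> K * prod_list (map norm vs)"
      using K L by (intro exI[of _ "K + L"]) auto
  qed
  then show ?thesis unfolding has_smooth_jet_def using D(1) E(1)
    by (intro exI[of _ "\<lambda>x vs. D x vs + E x vs"]) auto
qed

subsection \<open>The Leibniz rule\<close>

fun leibniz :: "('b \<Rightarrow> 'c \<Rightarrow> 'd::ab_group_add) \<Rightarrow> ('a list \<Rightarrow> 'b) \<Rightarrow> ('a list \<Rightarrow> 'c) \<Rightarrow> 'a list \<Rightarrow> 'd" where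
  "leibniz b D E [] = b (D []) (E [])"
| "leibniz b D E (v # vs) = leibniz b (\<lambda>us. D (v # us)) E vs + leibniz b D (\<lambda>ws. E (v # ws)) vs"

lemma leibniz_cong [fundef_cong]:
  assumes "b = b'" "vs = vs'" "\<And>us. length us \<le> length vs' \<Longrightarrow> D us = D' us"
    "\<And>us. length us \<le> length vs' \<Longrightarrow> E us = E' us"
  shows "leibniz b D E vs = leibniz b' D' E' vs'"
proof -
  have "leibniz b D E vs = leibniz b D' E' vs"
    if "\<And>us. length us \<le> length vs \<Longrightarrow> D us = D' us" "\<And>us. length us \<le> length vs \<Longrightarrow> E us = E' us"
    for D E D' E'
    using that
  proof (induction vs arbitrary: D E D' E')
    case (Cons v vs)
    have "leibniz b (\<lambda>us. D (v # us)) E vs = leibniz b (\<lambda>us. D' (v # us)) E' vs"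
      "leibniz b D (\<lambda>ws. E (v # ws)) vs = leibniz b D' (\<lambda>ws. E' (v # ws)) vs"
      by (rule Cons.IH; simp add: Cons.prems)+
    then show ?case by simp
  qed simp
  then show ?thesis using assms by blast
qed

lemma leibniz_norm_le:
  assumes b: "\<And>p q. norm (b p q) \<le> C * norm p * norm q" and "C \<ge> 0" "K \<ge> 0" "L \<ge> 0"
    and "\<And>us. length us \<le> length vs \<Longrightarrow> norm (D us) \<le> K * prod_list (map norm us)"
    and "\<And>us. length us \<le> length vs \<Longrightarrow> norm (E us) \<le> L * prod_list (map norm us)"
  shows "norm (leibniz b D E vs) \<le> 2 ^ length vs * C * K * L * prod_list (map norm vs)"
  using assms(3-)
proof (induction vs arbitrary: D E K L)
  case Nil
  have "norm (b (D []) (E [])) \<le> C * norm (D []) * norm (E [])" by (rule b)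
  also have "\<dots> \<le> C * K * L"
    using Nil.prems(3,4)[of "[]"] Nil.prems(1,2) \<open>C \<ge> 0\<close> by (intro mult_mono) auto
  finally show ?case by simp
next
  case (Cons v vs)
  have "norm (leibniz b (\<lambda>us. D (v # us)) E vs) \<le>
    2 ^ length vs * C * (K * norm v) * L * prod_list (map norm vs)"
    using Cons.prems(1,2) Cons.prems(3)[of "v # _"] Cons.prems(4)
    by (intro Cons.IH) (auto simp: mult.assoc)
  moreover have "norm (leibniz b D (\<lambda>ws. E (v # ws)) vs) \<le>
    2 ^ length vs * C * K * (L * norm v) * prod_list (map norm vs)"
    using Cons.prems(1,2,3) Cons.prems(4)[of "v # _"]
    by (intro Cons.IH) (auto simp: mult.assoc)
  ultimately show ?case
    by (auto simp: algebra_simps intro!: order_trans[OF norm_triangle_ineq])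
qed

lemma leibniz_linear_bilinear:
  assumes "\<And>p q. linear (\<lambda>v. m v p q)"
  shows "linear (\<lambda>v. leibniz (m v) D E vs)"
  by (induction vs arbitrary: D E) (auto intro: linear_compose_add assms)

lemma leibniz_linear_left:
  assumes "bounded_bilinear b" "\<And>us. length us \<le> length vs \<Longrightarrow> linear (\<lambda>v. D v us)"
  shows "linear (\<lambda>v. leibniz b (D v) E vs)"
  using assms(2)
proof (induction vs arbitrary: D E)
  case Nil
  interpret b: bounded_bilinear b by fact
  have "linear (\<lambda>p. b p (E []))" by (simp add: b.bounded_linear_left bounded_linear.linear)
  from linear_compose[OF Nil[of "[]"] this] show ?case by (simp add: o_def)
next
  case (Cons w vs)
  then show ?case by (auto intro!: linear_compose_add Cons.IH)
qed

lemma leibniz_linear_right: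
  assumes "bounded_bilinear b" "\<And>us. length us \<le> length vs \<Longrightarrow> linear (\<lambda>v. E v us)"
  shows "linear (\<lambda>v. leibniz b D (E v) vs)"
  using assms(2)
proof (induction vs arbitrary: D E)
  case Nil
  interpret b: bounded_bilinear b by fact
  have "linear (\<lambda>p. b (D []) p)" by (simp add: b.bounded_linear_right bounded_linear.linear)
  from linear_compose[OF Nil[of "[]"] this] show ?case by (simp add: o_def)
next
  case (Cons w vs)
  then show ?case by (auto intro!: linear_compose_add Cons.IH)
qed

lemma leibniz_linear_slot:
  assumes b: "bounded_bilinear b"
    and "\<And>us ws. length us + length ws \<le> length as + length bs \<Longrightarrow> linear (\<lambda>v. D (us @ v # ws))"
    and "\<And>us ws. length us + length ws \<le> length as + length bs \<Longrightarrow> linear (\<lambda>v. E (us @ v # ws))"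
  shows "linear (\<lambda>v. leibniz b D E (as @ v # bs))"
  using assms(2-)
proof (induction as arbitrary: D E)
  case Nil
  have "linear (\<lambda>v. leibniz b (\<lambda>us. D (v # us)) E bs)"
    using Nil.prems(1)[of "[]"] by (intro leibniz_linear_left[OF b]) auto
  moreover have "linear (\<lambda>v. leibniz b D (\<lambda>us. E (v # us)) bs)"
    using Nil.prems(2)[of "[]"] by (intro leibniz_linear_right[OF b]) auto
  ultimately show ?case by (auto intro: linear_compose_add)
next
  case (Cons a as)
  have "linear (\<lambda>v. leibniz b (\<lambda>us. D (a # us)) E (as @ v # bs))"
    using Cons.prems(1)[of "a # _"] Cons.prems(2) by (intro Cons.IH) auto
  moreover have "linear (\<lambda>v. leibniz b D (\<lambda>us. E (a # us)) (as @ v # bs))"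
    using Cons.prems(1) Cons.prems(2)[of "a # _"] by (intro Cons.IH) auto
  ultimately show ?case by (auto intro: linear_compose_add)
qed

lemma leibniz_has_derivative:
  assumes b: "bounded_bilinear b"
    and "\<And>us. length us \<le> length vs \<Longrightarrow> ((\<lambda>y. D y us) has_derivative (\<lambda>v. D' v us)) (at x)"
    and "\<And>us. length us \<le> length vs \<Longrightarrow> ((\<lambda>y. E y us) has_derivative (\<lambda>v. E' v us)) (at x)"
  shows "((\<lambda>y. leibniz b (D y) (E y) vs) has_derivative
    (\<lambda>v. leibniz b (D' v) (E x) vs + leibniz b (D x) (E' v) vs)) (at x)"
  using assms(2-)
proof (induction vs arbitrary: D D' E E')
  case Nil
  show ?case
    using bounded_bilinear.FDERIV[OF b Nil.prems(1)[of "[]"] Nil.prems(2)[of "[]"]]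
    by (simp add: add.commute)
next
  case (Cons w vs)
  have 1: "((\<lambda>y. leibniz b (\<lambda>us. D y (w # us)) (E y) vs) has_derivative
    (\<lambda>v. leibniz b (\<lambda>us. D' v (w # us)) (E x) vs + leibniz b (\<lambda>us. D x (w # us)) (E' v) vs)) (at x)"
    using Cons.prems by (intro Cons.IH) auto
  have 2: "((\<lambda>y. leibniz b (D y) (\<lambda>us. E y (w # us)) vs) has_derivative
    (\<lambda>v. leibniz b (D' v) (\<lambda>us. E x (w # us)) vs + leibniz b (D x) (\<lambda>us. E' v (w # us)) vs)) (at x)"
    using Cons.prems by (intro Cons.IH) auto
  from has_derivative_add[OF 1 2] show ?case
    by (simp add: add.commute add.left_commute add.assoc)
qed

lemma has_smooth_jet_bilinear:
  assumes b: "bounded_bilinear b" and "has_smooth_jet U f" "has_smooth_jet U g"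
  shows "has_smooth_jet U (\<lambda>x. b (f x) (g x))"
proof -
  obtain D E where D: "\<And>x. x \<in> U \<Longrightarrow> D x [] = f x" "\<And>n. smooth_jet U n D"
    and E: "\<And>x. x \<in> U \<Longrightarrow> E x [] = g x" "\<And>n. smooth_jet U n E"
    using assms unfolding has_smooth_jet_def by metis
  have "smooth_jet U n (\<lambda>x. leibniz b (D x) (E x))" for n
    unfolding smooth_jet_def
  proof (intro ballI conjI allI impI)
    fix x assume x: "x \<in> U"
    show "linear (\<lambda>v. leibniz b (D x) (E x) (us @ v # ws))" for us ws
      by (intro leibniz_linear_slot[OF b] smooth_jet_linear[OF D(2) x refl]
          smooth_jet_linear[OF E(2) x refl])
    show "((\<lambda>y. leibniz b (D y) (E y) vs) has_derivative (\<lambda>v. leibniz b (D x) (E x) (v # vs))) (at x)" for vs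
      unfolding leibniz.simps
      by (intro leibniz_has_derivative[OF b] smooth_jet_has_derivative[OF D(2) x refl]
          smooth_jet_has_derivative[OF E(2) x refl])
    obtain C where C: "C \<ge> 0" "\<And>p q. norm (b p q) \<le> C * norm p * norm q"
      using bounded_bilinear.nonneg_bounded[OF b] by (metis mult.commute mult.assoc)
    obtain K where K: "K \<ge> 0"
      "\<forall>\<^sub>F y in nhds x. \<forall>vs. length vs \<le> n \<longrightarrow> norm (D y vs) \<le> K * prod_list (map norm vs)"
      using smooth_jet_bound_upto[where n = n, OF D(2) x] by blast
    obtain L where L: "L \<ge> 0"
      "\<forall>\<^sub>F y in nhds x. \<forall>vs. length vs \<le> n \<longrightarrow> norm (E y vs) \<le> L * prod_list (map norm vs)"
      using smooth_jet_bound_upto[where n = n, OF E(2) x] by blast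
    have "\<forall>\<^sub>F y in nhds x. \<forall>vs. length vs = n \<longrightarrow>
      norm (leibniz b (D y) (E y) vs) \<le> (2 ^ n * C * K * L) * prod_list (map norm vs)"
      using K(2) L(2)
    proof eventually_elim
      case (elim y)
      then show ?case using leibniz_norm_le[OF C(2,1) K(1) L(1)] by blast
    qed
    then show "\<exists>K\<ge>0. \<forall>\<^sub>F y in nhds x. \<forall>vs. length vs = n \<longrightarrow>
      norm (leibniz b (D y) (E y) vs) \<le> K * prod_list (map norm vs)"
      using C(1) K(1) L(1) by (intro exI[of _ "2 ^ n * C * K * L"]) auto
  qed
  then show ?thesis unfolding has_smooth_jet_def using D(1) E(1)
    by (intro exI[of _ "\<lambda>x. leibniz b (D x) (E x)"]) auto
qed

subsection \<open>Smoothness of solutions of Riccati equations\<close>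

text \<open>The directions are listed with the newest one first, so the oldest direction, in which the
  equation \<open>Z' h = - m h Z Z\<close> itself is applied, is the last one.\<close>

function riccati_jet ::
  "('a \<Rightarrow> 'c \<Rightarrow> 'c \<Rightarrow> 'c::ab_group_add) \<Rightarrow> 'c \<Rightarrow> 'a list \<Rightarrow> 'c" where
  "riccati_jet m z vs = (if vs = [] then z
     else - leibniz (m (last vs)) (riccati_jet m z) (riccati_jet m z) (butlast vs))"
  by auto
termination
  by (relation "Wellfounded.measure (\<lambda>(m, z, vs). length vs)")
    (auto simp: length_greater_0_conv[symmetric] simp del: length_greater_0_conv)

declare riccati_jet.simps [simp del]

lemma riccati_jet_Nil: "riccati_jet m z [] = z"
  by (simp add: riccati_jet.simps)

lemma riccati_jet_snoc:
  "riccati_jet m z (vs @ [h]) = - leibniz (m h) (riccati_jet m z) (riccati_jet m z) vs"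
  by (simp add: riccati_jet.simps[of m z "vs @ [h]"])

lemma has_smooth_jet_riccati:
  fixes Z :: "'a::real_normed_vector \<Rightarrow> 'c::real_normed_vector"
  assumes Z: "\<And>x. x \<in> U \<Longrightarrow> (Z has_derivative (\<lambda>h. - m h (Z x) (Z x))) (at x)"
    and bil: "\<And>h. bounded_bilinear (m h)" and lin: "\<And>p q. linear (\<lambda>h. m h p q)"
    and C: "\<And>h p q. norm (m h p q) \<le> C * norm h * norm p * norm q" "C \<ge> 0"
  shows "has_smooth_jet U Z"
proof -
  define D where "D x = riccati_jet m (Z x)" for x
  have D_Nil: "D x [] = Z x" and D_snoc: "D x (vs @ [h]) = - leibniz (m h) (D x) (D x) vs" for x vs h
    by (simp_all add: D_def riccati_jet_Nil riccati_jet_snoc)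
  have "smooth_jet U n D" for n
  proof (induction n rule: less_induct)
    case (less n)
    show ?case
    proof (cases n)
      case 0
      have "((\<lambda>y. D y []) has_derivative (\<lambda>v. D x [v])) (at x)" if "x \<in> U" for x
        using Z[OF that] D_snoc[of x "[]"] by (simp add: D_Nil)
      moreover have "\<exists>K\<ge>0. \<forall>\<^sub>F y in nhds x. norm (D y []) \<le> K" if "x \<in> U" for x
      proof -
        have "isCont Z x" using Z[OF that] by (rule has_derivative_continuous)
        then have "\<forall>\<^sub>F y in nhds x. norm (Z y) < norm (Z x) + 1"
          by (intro order_tendstoD(2)[where y = "norm (Z x)"] tendsto_norm)
            (auto simp: isCont_def tendsto_at_iff_tendsto_nhds)
        then show ?thesis by (intro exI[of _ "norm (Z x) + 1"]) (auto simp: D_Nil elim: eventually_mono)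
      qed
      ultimately show ?thesis using 0 by (simp add: smooth_jet_def)
    next
      case (Suc k)
      have IH: "smooth_jet U i D" if "i \<le> k" for i using less that Suc by simp
      show ?thesis
        unfolding smooth_jet_def
      proof (intro ballI conjI allI impI)
        fix x and us ws :: "'a list" assume x: "x \<in> U" and len: "length us + length ws + 1 = n"
        show "linear (\<lambda>v. D x (us @ v # ws))"
        proof (cases ws rule: rev_cases)
          case Nil
          have "linear (\<lambda>v. leibniz (m v) (D x) (D x) us)"
            by (intro leibniz_linear_bilinear lin)
          from linear_compose_neg[OF this] show ?thesis by (simp add: Nil D_snoc)
        next
          case (snoc ws' h)
          have "linear (\<lambda>v. leibniz (m h) (D x) (D x) (us @ v # ws'))"
            using len Suc snoc
            by (intro leibniz_linear_slot[OF bil] smooth_jet_linear[OF IH x refl]) auto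
          from linear_compose_neg[OF this] show ?thesis
            using D_snoc[of x "us @ _ # ws'" h] by (simp add: snoc)
        qed
      next
        fix x and vs :: "'a list" assume x: "x \<in> U" and len: "length vs = n"
        obtain us h where vs: "vs = us @ [h]" "length us = k"
          using len Suc by (cases vs rule: rev_cases) auto
        have "((\<lambda>y. leibniz (m h) (D y) (D y) us) has_derivative
          (\<lambda>v. leibniz (m h) (\<lambda>us. D x (v # us)) (D x) us + leibniz (m h) (D x) (\<lambda>us. D x (v # us)) us)) (at x)"
          using vs(2) by (intro leibniz_has_derivative[OF bil] smooth_jet_has_derivative[OF IH x refl]) auto
        from has_derivative_minus[OF this]
        show "((\<lambda>y. D y vs) has_derivative (\<lambda>v. D x (v # vs))) (at x)"
          using D_snoc[of x "_ # us" h] by (simp add: vs(1) D_snoc)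
      next
        fix x assume x: "x \<in> U"
        obtain K where K: "K \<ge> 0"
          "\<forall>\<^sub>F y in nhds x. \<forall>vs. length vs \<le> k \<longrightarrow> norm (D y vs) \<le> K * prod_list (map norm vs)"
          using smooth_jet_bound_upto[where n = k, OF IH x] by blast
        have "\<forall>\<^sub>F y in nhds x. \<forall>vs. length vs = n \<longrightarrow>
          norm (D y vs) \<le> (2 ^ k * C * K * K) * prod_list (map norm vs)"
          using K(2)
        proof eventually_elim
          case (elim y)
          show ?case
          proof (intro allI impI)
            fix vs :: "'a list" assume len: "length vs = n"
            obtain us h where vs: "vs = us @ [h]" "length us = k"
              using len Suc by (cases vs rule: rev_cases) auto
            have "norm (leibniz (m h) (D y) (D y) us) \<le>
              2 ^ length us * (C * norm h) * K * K * prod_list (map norm us)"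
              using elim vs(2) K(1) C by (intro leibniz_norm_le) auto
            then show "norm (D y vs) \<le> (2 ^ k * C * K * K) * prod_list (map norm vs)"
              by (simp add: vs D_snoc ac_simps)
          qed
        qed
        then show "\<exists>K\<ge>0. \<forall>\<^sub>F y in nhds x. \<forall>vs. length vs = n \<longrightarrow>
          norm (D y vs) \<le> K * prod_list (map norm vs)"
          using K(1) C(2) by (intro exI[of _ "2 ^ k * C * K * K"]) auto
      qed
    qed
  qed
  then show ?thesis unfolding has_smooth_jet_def by (intro exI[of _ D]) (simp add: D_Nil)
qed

subsection \<open>Inverses near the identity\<close>

lemma id_plus_inverse_exists:
  fixes K :: "'a::banach \<Rightarrow>\<^sub>L 'a"
  assumes K: "norm K < 1"
  obtains Z where "blinfun_inverses (id_blinfun + K) Z"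
proof -
  have "\<exists>!z. u - K z = z" for u
  proof (rule banach_fix_type[where c = "norm K"])
    have "dist (u - K x) (u - K y) = norm (K (x - y))" for x y
      by (simp add: dist_norm blinfun.diff_right norm_minus_commute)
    then show "\<forall>x y. dist (u - K x) (u - K y) \<le> norm K * dist x y"
      using norm_blinfun[of K] by (simp add: dist_norm)
  qed (use K in auto)
  then obtain z where z: "\<And>u. u - K (z u) = z u" and uniq: "\<And>u x. u - K x = x \<Longrightarrow> x = z u"
    by metis
  have "bounded_linear z"
  proof (rule bounded_linear_intro[where K = "1 / (1 - norm K)"])
    fix u v
    have "u + v - K (z u + z v) = (u - K (z u)) + (v - K (z v))"
      by (simp add: blinfun.add_right)
    then show "z (u + v) = z u + z v" using uniq[of "u + v"] z by simp
  next
    fix r u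
    have "r *\<^sub>R u - K (r *\<^sub>R z u) = r *\<^sub>R (u - K (z u))"
      by (simp add: blinfun.scaleR_right scaleR_diff_right)
    then show "z (r *\<^sub>R u) = r *\<^sub>R z u" using uniq[of "r *\<^sub>R u"] z by simp
  next
    fix u
    have "norm (z u) \<le> norm u + norm (K (z u))"
      using norm_triangle_ineq4[of u "K (z u)"] by (simp add: z)
    also have "\<dots> \<le> norm u + norm K * norm (z u)" using norm_blinfun[of K "z u"] by simp
    finally show "norm (z u) \<le> norm u * (1 / (1 - norm K))"
      using K by (simp add: field_simps)
  qed
  then have Z: "blinfun_apply (Blinfun z) = z" by (rule bounded_linear_Blinfun_apply)
  have right: "z u + K (z u) = u" for u using z[of u] by (metis diff_add_cancel)
  have left: "z (u + K u) = u" for u using uniq[of "u + K u" u] by simp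
  have "blinfun_inverses (id_blinfun + K) (Blinfun z)"
    unfolding blinfun_inverses_def
    by (intro conjI blinfun_eqI) (simp_all add: Z blinfun.add_left right left)
  then show thesis by (rule that)
qed

lemma norm_blinfun_compose3: "norm (p o\<^sub>L h o\<^sub>L q) \<le> norm p * norm h * norm q"
  by (rule order_trans[OF norm_blinfun_compose mult_right_mono[OF norm_blinfun_compose norm_ge_zero]])

lemma has_derivative_blinfun_inverse:
  fixes Z :: "'c::real_normed_vector \<Rightarrow> 'a::banach \<Rightarrow>\<^sub>L 'a"
  assumes U: "open U" "x \<in> U" and L: "bounded_linear L"
    and Z: "\<And>y. y \<in> U \<Longrightarrow> blinfun_inverses (id_blinfun + L (y - a)) (Z y)"
  shows "(Z has_derivative (\<lambda>h. - (Z x o\<^sub>L L h o\<^sub>L Z x))) (at x)"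
proof -
  interpret L: bounded_linear L by fact
  obtain B where B: "B > 0" "\<And>h. norm (L h) \<le> norm h * B" using L.pos_bounded by blast
  obtain r where r: "r > 0" "ball x r \<subseteq> U" using U by (metis open_contains_ball)
  define e where "e = min r (1 / (2 * B * (norm (Z x) + 1)))"
  have e: "e > 0" using r(1) B(1) by (simp add: e_def add_nonneg_pos)
  have res: "Z y - Z x = - (Z y o\<^sub>L L (y - x) o\<^sub>L Z x)" if "y \<in> U" for y
  proof (rule blinfun_eqI)
    fix u
    have Lyx: "L (y - x) = L (y - a) - L (x - a)" by (simp flip: L.diff)
    have 1: "Z x u + L (x - a) (Z x u) = u"
      using blinfun_inverses_apply(1)[OF Z[OF U(2)], of u] by (simp add: blinfun.add_left)
    have 2: "Z y (w + L (y - a) w) = w" for w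
      using blinfun_inverses_apply(2)[OF Z[OF that], of w] by (simp add: blinfun.add_left)
    have "Z y (L (y - x) (Z x u)) = Z y ((Z x u + L (y - a) (Z x u)) - (Z x u + L (x - a) (Z x u)))"
      by (simp add: Lyx blinfun.diff_left)
    also have "\<dots> = Z x u - Z y u" by (simp only: blinfun.diff_right 1 2)
    finally show "(Z y - Z x) u = (- (Z y o\<^sub>L L (y - x) o\<^sub>L Z x)) u"
      by (simp add: blinfun.diff_left blinfun.minus_left)
  qed
  have bd: "norm (Z y) \<le> 2 * norm (Z x)" if y: "dist y x < e" for y
  proof -
    have yU: "y \<in> U" using y r(2) by (auto simp: e_def dist_commute)
    have "norm (y - x) < 1 / (2 * B * (norm (Z x) + 1))"
      using y by (simp add: e_def dist_norm)
    then have "norm (y - x) * (2 * B * (norm (Z x) + 1)) < 1"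
      using B(1) by (subst (asm) pos_less_divide_eq) (simp_all add: add_nonneg_pos)
    then have "2 * (norm (y - x) * B * norm (Z x)) \<le> 1"
      using mult_nonneg_nonneg[OF less_imp_le[OF B(1)] norm_ge_zero, of "y - x"]
      by (simp add: algebra_simps)
    then have small: "norm (y - x) * B * norm (Z x) \<le> 1 / 2" by simp
    have "norm (Z y) \<le> norm (Z x) + norm (Z y o\<^sub>L L (y - x) o\<^sub>L Z x)"
    proof -
      have "Z y = Z x - (Z y o\<^sub>L L (y - x) o\<^sub>L Z x)"
        using arg_cong[OF res[OF yU], of "\<lambda>d. Z x + d"] by simp
      then show ?thesis using norm_triangle_ineq4 by metis
    qed
    also have "\<dots> \<le> norm (Z x) + norm (Z y) * norm (L (y - x)) * norm (Z x)"
      using norm_blinfun_compose3 by (intro add_left_mono)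
    also have "\<dots> \<le> norm (Z x) + norm (Z y) * (norm (y - x) * B) * norm (Z x)"
      using B(2) by (intro add_left_mono mult_right_mono mult_left_mono) auto
    also have "\<dots> = norm (Z x) + norm (Z y) * (norm (y - x) * B * norm (Z x))" by simp
    also have "\<dots> \<le> norm (Z x) + norm (Z y) * (1 / 2)"
      using small by (intro add_left_mono mult_left_mono) auto
    finally show ?thesis by simp
  qed
  define H where "H y = 2 * norm (Z x) * (norm (y - x) * B) * norm (Z x) * B * norm (Z x)" for y
  show ?thesis
  proof (rule has_derivativeI_sandwich[OF e])
    show "bounded_linear (\<lambda>h. - (Z x o\<^sub>L L h o\<^sub>L Z x))"
      by (intro bounded_linear_minus bounded_bilinear.bounded_linear_left[OF bounded_bilinear_blinfun_compose, THEN bounded_linear_compose]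
          bounded_bilinear.bounded_linear_right[OF bounded_bilinear_blinfun_compose, THEN bounded_linear_compose] L)
    show "(H \<longlongrightarrow> 0) (at x)"
      unfolding H_def by (auto intro!: tendsto_eq_intros)
    fix y assume y: "y \<noteq> x" "dist y x < e"
    have yU: "y \<in> U" using y r(2) by (auto simp: e_def dist_commute)
    let ?h = "L (y - x)"
    have "Z y - Z x - - (Z x o\<^sub>L ?h o\<^sub>L Z x) = - (Z y o\<^sub>L ?h o\<^sub>L Z x) - - (Z x o\<^sub>L ?h o\<^sub>L Z x)"
      by (simp only: res[OF yU])
    also have "\<dots> = - ((Z y - Z x) o\<^sub>L ?h o\<^sub>L Z x)"
      by (rule blinfun_eqI) (simp add: blinfun.bilinear_simps)
    also have "\<dots> = Z y o\<^sub>L ?h o\<^sub>L Z x o\<^sub>L ?h o\<^sub>L Z x"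
      unfolding res[OF yU] by (rule blinfun_eqI) (simp add: blinfun.bilinear_simps)
    also have "norm \<dots> \<le> norm (Z y) * norm ?h * norm (Z x) * norm ?h * norm (Z x)"
      by (intro order_trans[OF norm_blinfun_compose3] mult_right_mono norm_blinfun_compose3) auto
    also have "\<dots> \<le> 2 * norm (Z x) * (norm (y - x) * B) * norm (Z x) * (norm (y - x) * B) * norm (Z x)"
      using bd[OF y(2)] B by (intro mult_mono mult_nonneg_nonneg) auto
    also have "\<dots> = H y * norm (y - x)" by (simp add: H_def)
    finally show "norm (Z y - Z x - - (Z x o\<^sub>L L (y - x) o\<^sub>L Z x)) / norm (y - x) \<le> H y"
      using y(1) by (simp add: divide_le_eq)
  qed
qed

subsection \<open>The chart\<close>

locale generalized_inverse =
  fixes X :: "'a::banach \<Rightarrow>\<^sub>L 'b::banach" and A :: "'b \<Rightarrow>\<^sub>L 'a"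
  assumes XAX: "X o\<^sub>L A o\<^sub>L X = X" and AXA: "A o\<^sub>L X o\<^sub>L A = A"
begin

lemma XAX_apply [simp]: "X (A (X x)) = X x"
  using XAX by (metis blinfun_apply_blinfun_compose)

lemma AXA_apply [simp]: "A (X (A y)) = A y"
  using AXA by (metis blinfun_apply_blinfun_compose)

definition P where "P = id_blinfun - (A o\<^sub>L X)"
definition Q where "Q = id_blinfun - (X o\<^sub>L A)"

lemma P_apply: "P x = x - A (X x)"
  by (simp add: P_def blinfun.diff_left)

lemma Q_apply: "Q y = y - X (A y)"
  by (simp add: Q_def blinfun.diff_left)

definition corner :: "('a \<Rightarrow>\<^sub>L 'b) \<Rightarrow> ('a \<Rightarrow>\<^sub>L 'b)" where
  "corner Y = Q o\<^sub>L Y o\<^sub>L P"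

lemma bounded_linear_corner: "bounded_linear corner"
  unfolding corner_def
  by (intro bounded_bilinear.bounded_linear_left[OF bounded_bilinear_blinfun_compose, THEN bounded_linear_compose]
      bounded_bilinear.bounded_linear_right[OF bounded_bilinear_blinfun_compose])

lemma corner_corner: "corner (corner Y) = corner Y"
  by (rule blinfun_eqI) (simp add: corner_def P_apply Q_apply blinfun.bilinear_simps)

lemma M_space_eq: "M_space X = {Y. corner Y = 0}"
proof (intro set_eqI iffI)
  fix Y assume Y: "Y \<in> M_space X"
  have "corner Y x = 0" for x
  proof -
    have "P x \<in> null_space X" by (simp add: null_space_def P_apply blinfun.diff_right)
    then obtain z where "Y (P x) = X z" using Y by (auto simp: M_space_def range_space_def)
    then show ?thesis by (simp add: corner_def Q_apply)
  qed
  then show "Y \<in> {Y. corner Y = 0}" by (auto intro: blinfun_eqI)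
next
  fix Y assume "Y \<in> {Y. corner Y = 0}"
  then have Y: "Q (Y (P x)) = 0" for x
    by (metis (mono_tags) blinfun_apply_blinfun_compose corner_def mem_Collect_eq zero_blinfun.rep_eq)
  have "Y x \<in> range_space X" if "x \<in> null_space X" for x
  proof -
    have "P x = x" using that by (simp add: P_apply null_space_def)
    then have "Y x = X (A (Y x))" using Y[of x] by (simp add: Q_apply)
    then show ?thesis unfolding range_space_def by (metis rangeI)
  qed
  then show "Y \<in> M_space X" by (auto simp: M_space_def)
qed

lemma splitting_M_space: "splitting (M_space X) {Y. corner Y = Y}"
proof -
  interpret corner: bounded_linear corner by (rule bounded_linear_corner)
  show ?thesis
    unfolding splitting_def algebraic_complement_def M_space_eq
  proof (intro conjI allI)
    show "closed {Y. corner Y = 0}" "closed {Y. corner Y = Y}"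
      by (intro closed_Collect_eq continuous_intros corner.continuous_on)+
    show "subspace {Y. corner Y = 0}" "subspace {Y. corner Y = Y}"
      by (simp_all add: subspace_def corner.add corner.scaleR corner.zero)
    show "{Y. corner Y = 0} \<inter> {Y. corner Y = Y} = {0}" by (auto simp: corner.zero)
    show "\<exists>v\<in>{Y. corner Y = 0}. \<exists>w\<in>{Y. corner Y = Y}. Y = v + w" for Y
      by (intro bexI[of _ "Y - corner Y"] bexI[of _ "corner Y"]) (auto simp: corner.diff corner_corner)
  qed
qed

definition W where "W = {T. norm ((T - X) o\<^sub>L A) < 1}"
definition V where "V = {Y :: 'a \<Rightarrow>\<^sub>L 'b. norm (Y o\<^sub>L A) < 1}"

definition Z where "Z T = (SOME Z. blinfun_inverses (id_blinfun + ((T - X) o\<^sub>L A)) Z)"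

definition chart where "chart T = ((T - X) o\<^sub>L (A o\<^sub>L X)) + (Z T o\<^sub>L ((T - X) o\<^sub>L P))"
definition param where "param Y = X + Y + ((Y o\<^sub>L A) o\<^sub>L (Y o\<^sub>L P))"

lemma continuous_on_compose_left: "continuous_on S (\<lambda>Y. Y o\<^sub>L B)"
  for B :: "'c::real_normed_vector \<Rightarrow>\<^sub>L 'd::real_normed_vector"
  by (intro linear_continuous_on bounded_bilinear.bounded_linear_left[OF bounded_bilinear_blinfun_compose])

lemma open_V: "open V"
  unfolding V_def by (intro open_Collect_less continuous_intros continuous_on_compose_left)

lemma W_eq: "W = (\<lambda>T. T - X) -` V"
  by (auto simp: W_def V_def)

lemma open_W: "open W"
  unfolding W_eq by (intro open_vimage open_V continuous_intros)

lemma Z_inverses: "T \<in> W \<Longrightarrow> blinfun_inverses (id_blinfun + ((T - X) o\<^sub>L A)) (Z T)"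
  unfolding Z_def W_def by (metis (mono_tags) id_plus_inverse_exists mem_Collect_eq someI)

lemma Z_apply: "T \<in> W \<Longrightarrow> Z T y + (T - X) (A (Z T y)) = y"
  "T \<in> W \<Longrightarrow> Z T (y + (T - X) (A y)) = y"
  using blinfun_inverses_apply[OF Z_inverses, of T] by (simp_all add: blinfun.add_left)

lemma chart_compose_A: "chart T o\<^sub>L A = (T - X) o\<^sub>L A"
  by (rule blinfun_eqI) (simp add: chart_def P_apply blinfun.add_left)

lemma param_compose_A: "(param Y - X) o\<^sub>L A = Y o\<^sub>L A"
  by (rule blinfun_eqI) (simp add: param_def P_apply blinfun.add_left)

lemma param_chart:
  assumes "T \<in> W"
  shows "param (chart T) = T"
proof (rule blinfun_eqI)
  fix x
  let ?y = "(T - X) (P x)"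
  have PP: "P (P x) = P x" "X (P x) = 0" by (simp_all add: P_apply blinfun.diff_right)
  have "chart T (A y) = (T - X) (A y)" for y
    using chart_compose_A[of T] by (metis blinfun_apply_blinfun_compose)
  moreover have "chart T (P x) = Z T ?y" by (simp add: chart_def blinfun.add_left PP)
  moreover have "chart T x = (T - X) (A (X x)) + Z T ?y" by (simp add: chart_def blinfun.add_left)
  ultimately have "param (chart T) x = X x + (T - X) (A (X x)) + (Z T ?y + (T - X) (A (Z T ?y)))"
    by (simp add: param_def blinfun.add_left)
  also have "\<dots> = X x + (T - X) (A (X x)) + (T - X) (P x)"
    by (simp only: Z_apply(1)[OF assms])
  also have "\<dots> = T x" by (simp add: P_apply blinfun.diff_left blinfun.diff_right)
  finally show "param (chart T) x = T x" .
qed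

lemma param_in_W: "Y \<in> V \<Longrightarrow> param Y \<in> W"
  by (simp add: V_def W_def param_compose_A)

lemma chart_in_V: "T \<in> W \<Longrightarrow> chart T \<in> V"
  by (simp add: V_def W_def chart_compose_A)

lemma chart_param:
  assumes "Y \<in> V"
  shows "chart (param Y) = Y"
proof (rule blinfun_eqI)
  fix x
  have A: "(param Y - X) (A y) = Y (A y)" for y
    using param_compose_A[of Y] by (metis blinfun_apply_blinfun_compose)
  have "P (P x) = P x" by (simp add: P_apply blinfun.diff_right)
  then have "(param Y - X) (P x) = Y (P x) + (param Y - X) (A (Y (P x)))"
    by (simp add: A) (simp add: param_def blinfun.add_left)
  then have "chart (param Y) x = Y (A (X x)) + Y (P x)"
    using Z_apply(2)[OF param_in_W[OF assms], of "Y (P x)"]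
    by (simp add: chart_def blinfun.add_left A)
  then show "chart (param Y) x = Y x" by (simp add: P_apply blinfun.diff_right)
qed

lemma X_in_W: "X \<in> W"
  by (simp add: W_def)

lemma has_derivative_Z: "T \<in> W \<Longrightarrow> (Z has_derivative (\<lambda>h. - (Z T o\<^sub>L (h o\<^sub>L A) o\<^sub>L Z T))) (at T)"
  by (rule has_derivative_blinfun_inverse[OF open_W _
        bounded_bilinear.bounded_linear_left[OF bounded_bilinear_blinfun_compose] Z_inverses])

lemma has_smooth_jet_Z: "has_smooth_jet W Z"
proof (rule has_smooth_jet_riccati[where m = "\<lambda>h p q. p o\<^sub>L (h o\<^sub>L A) o\<^sub>L q" and C = "norm A"])
  show "(Z has_derivative (\<lambda>h. - (Z T o\<^sub>L (h o\<^sub>L A) o\<^sub>L Z T))) (at T)" if "T \<in> W" for T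
    using that by (rule has_derivative_Z)
  show "linear (\<lambda>h. p o\<^sub>L (h o\<^sub>L A) o\<^sub>L q)" for p q :: "'b \<Rightarrow>\<^sub>L 'b"
    by (rule linearI; rule blinfun_eqI) (simp_all add: blinfun.bilinear_simps)
  show bound: "norm (p o\<^sub>L (h o\<^sub>L A) o\<^sub>L q) \<le> norm A * norm h * norm p * norm q" for p q :: "'b \<Rightarrow>\<^sub>L 'b" and h :: "'a \<Rightarrow>\<^sub>L 'b"
  proof -
    have "norm (p o\<^sub>L (h o\<^sub>L A) o\<^sub>L q) \<le> norm p * norm (h o\<^sub>L A) * norm q" by (rule norm_blinfun_compose3)
    also have "\<dots> \<le> norm p * (norm h * norm A) * norm q"
      by (intro mult_right_mono mult_left_mono norm_blinfun_compose) auto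
    finally show ?thesis by (simp add: ac_simps)
  qed
  show "bounded_bilinear (\<lambda>(p :: 'b \<Rightarrow>\<^sub>L 'b) (q :: 'b \<Rightarrow>\<^sub>L 'b). p o\<^sub>L (h o\<^sub>L A) o\<^sub>L q)"
    for h :: "'a \<Rightarrow>\<^sub>L 'b"
  proof
    show "\<exists>K. \<forall>(p :: 'b \<Rightarrow>\<^sub>L 'b) (q :: 'b \<Rightarrow>\<^sub>L 'b). norm (p o\<^sub>L (h o\<^sub>L A) o\<^sub>L q) \<le> norm p * norm q * K"
      using bound[of _ h] by (intro exI[of _ "norm A * norm h"]) (simp add: ac_simps)
  qed (rule blinfun_eqI, simp add: blinfun.bilinear_simps)+
qed simp

lemma has_smooth_jet_compose_left: "has_smooth_jet U (\<lambda>T. (T - C) o\<^sub>L B)"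
  for B :: "'c::real_normed_vector \<Rightarrow>\<^sub>L 'd::real_normed_vector" and C :: "'d \<Rightarrow>\<^sub>L 'e::real_normed_vector"
proof -
  have eq: "(\<lambda>T. (T - C) o\<^sub>L B) = (\<lambda>T. (T o\<^sub>L B) + - (C o\<^sub>L B))"
    by (simp add: bounded_bilinear.diff_left[OF bounded_bilinear_blinfun_compose])
  show ?thesis unfolding eq
    by (intro has_smooth_jet_affine bounded_bilinear.bounded_linear_left[OF bounded_bilinear_blinfun_compose])
qed

lemma has_smooth_jet_chart: "has_smooth_jet W chart"
  unfolding chart_def [abs_def]
  by (intro has_smooth_jet_add has_smooth_jet_bilinear[OF bounded_bilinear_blinfun_compose]
      has_smooth_jet_compose_left has_smooth_jet_Z)

lemma has_smooth_jet_param: "has_smooth_jet V param"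
proof -
  have "has_smooth_jet V (\<lambda>Y. Y + X)"
    by (rule has_smooth_jet_affine[OF bounded_linear_ident])
  moreover have "has_smooth_jet V (\<lambda>Y. (Y o\<^sub>L A) o\<^sub>L (Y o\<^sub>L P))"
    using has_smooth_jet_bilinear[OF bounded_bilinear_blinfun_compose
        has_smooth_jet_compose_left[of V 0 A] has_smooth_jet_compose_left[of V 0 P]]
    by simp
  ultimately show ?thesis
    unfolding param_def [abs_def] by (subst add.commute[of X]) (rule has_smooth_jet_add)
qed

lemma smooth_diffeo_chart: "smooth_diffeo W V chart"
proof -
  have bij: "bij_betw chart W V"
    by (rule bij_betw_byWitness[where f' = param])
      (auto simp: param_chart chart_param param_in_W chart_in_V)
  have inv: "inv_into W chart Y = param Y" if "Y \<in> V" for Y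
    using bij that by (intro inv_into_f_eq) (auto simp: bij_betw_def chart_param param_in_W)
  have "has_smooth_jet V (inv_into W chart)"
    using has_smooth_jet_param inv unfolding has_smooth_jet_def by simp
  then show ?thesis
    unfolding smooth_diffeo_def
    using bij by (auto intro: open_V open_W smooth_map_on_if_has_smooth_jet has_smooth_jet_chart)
qed

lemma param_factorization:
  "param Y = (id_blinfun + (Y o\<^sub>L A)) o\<^sub>L (X + corner Y) o\<^sub>L (id_blinfun + (A o\<^sub>L Y o\<^sub>L P))"
  by (rule blinfun_eqI)
    (simp add: param_def corner_def P_apply Q_apply blinfun.bilinear_simps)

lemma right_factor_inverses:
  "blinfun_inverses (id_blinfun + (A o\<^sub>L Y o\<^sub>L P)) (id_blinfun - (A o\<^sub>L Y o\<^sub>L P))"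
  unfolding blinfun_inverses_def
  by (intro conjI blinfun_eqI) (simp_all add: P_apply blinfun.bilinear_simps)

lemma block_diagonal_in_class:
  assumes S: "operator_class k m n S" "X \<in> S" "X + corner Y \<in> S"
  shows "corner Y = 0"
proof -
  let ?K = "corner Y"
  have K: "Q (X x) = 0" "Q (?K x) = ?K x" "?K (P x) = ?K x" "?K (A y) = 0" "X (P x) = 0" for x y
    by (simp_all add: corner_def P_apply Q_apply blinfun.bilinear_simps)
  have "null_space (X + ?K) \<subseteq> null_space X"
  proof
    fix x assume "x \<in> null_space (X + ?K)"
    then have 0: "X x + ?K x = 0" by (simp add: null_space_def blinfun.add_left)
    then have "Q (X x + ?K x) = 0" by simp
    then have "?K x = 0" by (simp add: blinfun.add_right K)
    then show "x \<in> null_space X" using 0 by (simp add: null_space_def)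
  qed
  moreover have "range_space X \<subseteq> range_space (X + ?K)"
  proof -
    have "X x = (X + ?K) (A (X x))" for x by (simp add: blinfun.add_left K)
    then show ?thesis unfolding range_space_def by (metis image_subsetI rangeI)
  qed
  ultimately consider "null_space (X + ?K) = null_space X" | "range_space X = range_space (X + ?K)"
    using operator_class_null_or_range_eq[OF S] by blast
  then have "?K x = 0" for x
  proof cases
    case 1
    have "P x \<in> null_space (X + ?K)" unfolding 1 by (simp add: null_space_def K)
    then show ?thesis by (simp add: null_space_def blinfun.add_left K)
  next
    case 2
    have "(X + ?K) (P x) \<in> range_space X" unfolding 2 by (simp add: range_space_def)
    then obtain z where "?K x = X z" by (auto simp: range_space_def blinfun.add_left K)
    then show ?thesis using K(1)[of z] K(2)[of x] by simp
  qed
  then show ?thesis by (auto intro: blinfun_eqI)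
qed

lemma param_in_class_iff:
  assumes S: "operator_class k m n S" "X \<in> S" and Y: "Y \<in> V"
  shows "param Y \<in> S \<longleftrightarrow> corner Y = 0"
proof -
  let ?G = "id_blinfun + (Y o\<^sub>L A)" and ?H = "id_blinfun + (A o\<^sub>L Y o\<^sub>L P)"
  let ?H' = "id_blinfun - (A o\<^sub>L Y o\<^sub>L P)"
  obtain G' where G: "blinfun_inverses ?G G'"
    using id_plus_inverse_exists[of "Y o\<^sub>L A"] Y by (auto simp: V_def)
  note H = right_factor_inverses[of Y]
  have "G' o\<^sub>L param Y o\<^sub>L ?H' = X + corner Y"
    unfolding param_factorization
    by (rule blinfun_eqI)
      (simp only: blinfun_apply_blinfun_compose blinfun_inverses_apply[OF G] blinfun_inverses_apply[OF H])
  moreover have "G' o\<^sub>L param Y o\<^sub>L ?H' \<in> S" if "param Y \<in> S"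
    by (rule operator_class_equivalent[OF S(1) that blinfun_inverses_sym[OF G] blinfun_inverses_sym[OF H]])
  moreover have "param Y \<in> S" if "corner Y = 0"
    using operator_class_equivalent[OF S G H] that unfolding param_factorization by simp
  ultimately show ?thesis using block_diagonal_in_class[OF S, of Y] by auto
qed

lemma chart_image:
  assumes S: "operator_class k m n S" "X \<in> S"
  shows "chart ` (S \<inter> W) = M_space X \<inter> V"
proof (intro set_eqI iffI)
  fix Y assume "Y \<in> chart ` (S \<inter> W)"
  then obtain T where T: "T \<in> S" "T \<in> W" "Y = chart T" by blast
  then have "param Y \<in> S" "Y \<in> V" by (simp_all add: param_chart chart_in_V)
  then show "Y \<in> M_space X \<inter> V" using param_in_class_iff[OF S] by (simp add: M_space_eq)
next
  fix Y assume "Y \<in> M_space X \<inter> V"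
  then have Y: "Y \<in> V" "param Y \<in> S" using param_in_class_iff[OF S] by (auto simp: M_space_eq)
  then show "Y \<in> chart ` (S \<inter> W)"
    by (intro image_eqI[of _ _ "param Y"]) (auto simp: chart_param param_in_W)
qed

lemma corner_chart: "corner (chart T) = Q o\<^sub>L Z T o\<^sub>L (T - X) o\<^sub>L P"
  by (rule blinfun_eqI) (simp add: corner_def chart_def P_apply blinfun.bilinear_simps)

lemma Z_X: "Z X = id_blinfun"
  by (rule blinfun_eqI) (use Z_apply(1)[OF X_in_W] in simp)

lemma velocity_in_M_space:
  assumes S: "operator_class k m n S" "X \<in> S"
    and c: "(c has_vector_derivative v) (at 0)" "c 0 = X" "e > 0" "\<And>t. \<bar>t\<bar> < e \<Longrightarrow> c t \<in> S"
  shows "v \<in> M_space X"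
proof -
  have "isCont c 0" using c(1) by (rule has_vector_derivative_continuous)
  then have cX: "(c \<longlongrightarrow> X) (at 0)" using c(2) by (simp add: isCont_def)
  have "isCont Z X" using has_derivative_continuous[OF has_derivative_Z[OF X_in_W]] .
  then have ZX: "((\<lambda>t. Z (c t)) \<longlongrightarrow> id_blinfun) (at 0)"
    using isCont_tendsto_compose[OF _ cX, of Z] by (simp add: Z_X)
  have "((\<lambda>h. norm (c (0 + h) - c 0 - h *\<^sub>R v) / norm h) \<longlongrightarrow> 0) (at 0)"
    using c(1) unfolding has_vector_derivative_def has_derivative_at by blast
  then have "((\<lambda>h. norm ((1 / h) *\<^sub>R (c h - X) - v)) \<longlongrightarrow> 0) (at 0)"
  proof (rule Lim_transform_eventually)
    have "norm (c (0 + h) - c 0 - h *\<^sub>R v) / norm h = norm ((1 / h) *\<^sub>R (c h - X) - v)" if "h \<noteq> 0" for h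
    proof -
      have "(1 / h) *\<^sub>R (c h - X) - v = (1 / h) *\<^sub>R (c h - X - h *\<^sub>R v)"
        using that by (simp add: scaleR_diff_right)
      then show ?thesis by (simp add: c(2) divide_inverse mult.commute)
    qed
    then show "\<forall>\<^sub>F h in at 0. norm (c (0 + h) - c 0 - h *\<^sub>R v) / norm h = norm ((1 / h) *\<^sub>R (c h - X) - v)"
      by (simp add: eventually_at_filter)
  qed
  then have "((\<lambda>h. (1 / h) *\<^sub>R (c h - X)) \<longlongrightarrow> v) (at 0)"
    by (simp add: tendsto_norm_zero_iff LIM_zero_iff)
  then have lim: "((\<lambda>h. Q o\<^sub>L Z (c h) o\<^sub>L ((1 / h) *\<^sub>R (c h - X)) o\<^sub>L P) \<longlongrightarrow> Q o\<^sub>L id_blinfun o\<^sub>L v o\<^sub>L P) (at 0)"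
    by (intro bounded_bilinear.tendsto[OF bounded_bilinear_blinfun_compose] tendsto_const ZX)
  have "\<forall>\<^sub>F h in at 0. c h \<in> W"
    using cX open_W X_in_W by (rule topological_tendstoD)
  moreover have "\<forall>\<^sub>F h in at 0. \<bar>h\<bar> < e"
    using c(3) by (auto simp: eventually_at dist_real_def)
  ultimately have "\<forall>\<^sub>F h in at 0. Q o\<^sub>L Z (c h) o\<^sub>L ((1 / h) *\<^sub>R (c h - X)) o\<^sub>L P = 0"
  proof eventually_elim
    case (elim h)
    then have "chart (c h) \<in> M_space X" using chart_image[OF S] c(4) by blast
    then have "Q o\<^sub>L Z (c h) o\<^sub>L (c h - X) o\<^sub>L P = 0" by (simp add: M_space_eq corner_chart)
    moreover have "Q o\<^sub>L Z (c h) o\<^sub>L ((1 / h) *\<^sub>R (c h - X)) o\<^sub>L P =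
      (1 / h) *\<^sub>R (Q o\<^sub>L Z (c h) o\<^sub>L (c h - X) o\<^sub>L P)"
      by (rule blinfun_eqI) (simp add: blinfun.bilinear_simps)
    ultimately show ?case by simp
  qed
  then have "((\<lambda>h. Q o\<^sub>L Z (c h) o\<^sub>L ((1 / h) *\<^sub>R (c h - X)) o\<^sub>L P) \<longlongrightarrow> 0) (at 0)"
    by (rule tendsto_eventually)
  with lim have "Q o\<^sub>L id_blinfun o\<^sub>L v o\<^sub>L P = 0"
    by (intro tendsto_unique[OF _ lim]) simp_all
  moreover have "Q o\<^sub>L id_blinfun = Q" by (rule blinfun_eqI) simp
  ultimately show ?thesis by (simp add: M_space_eq corner_def)
qed

lemma curve_with_velocity:
  assumes S: "operator_class k m n S" "X \<in> S" and v: "v \<in> M_space X"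
  shows "v \<in> curve_velocities S X"
proof -
  define w where "w = (v o\<^sub>L A) o\<^sub>L (v o\<^sub>L P)"
  define c where "c t = X + t *\<^sub>R v + (t * t) *\<^sub>R w" for t :: real
  define e where "e = 1 / (norm (v o\<^sub>L A) + 1)"
  have e: "e > 0" by (simp add: e_def add_nonneg_pos)
  have param: "c t = param (t *\<^sub>R v)" for t
    by (rule blinfun_eqI) (simp add: c_def w_def param_def blinfun.bilinear_simps)
  have deriv: "(c has_vector_derivative (v + (2 * t) *\<^sub>R w)) (at t)" for t
    unfolding c_def
    by (auto intro!: derivative_eq_intros simp: has_vector_derivative_def algebra_simps)
  have "c C1_differentiable_on {-e<..<e}"
    unfolding C1_differentiable_on_def
    using deriv by (intro exI[of _ "\<lambda>t. v + (2 * t) *\<^sub>R w"] conjI ballI continuous_intros)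
  moreover have "c ` {-e<..<e} \<subseteq> S"
  proof clarify
    fix t assume t: "t \<in> {-e<..<e}"
    have "norm ((t *\<^sub>R v) o\<^sub>L A) = \<bar>t\<bar> * norm (v o\<^sub>L A)"
      by (simp add: bounded_bilinear.scaleR_left[OF bounded_bilinear_blinfun_compose])
    also have "\<dots> \<le> \<bar>t\<bar> * (norm (v o\<^sub>L A) + 1)" by (intro mult_left_mono) auto
    also have "\<dots> < 1"
    proof -
      have "\<bar>t\<bar> < 1 / (norm (v o\<^sub>L A) + 1)" using t by (auto simp: e_def)
      then show ?thesis by (subst (asm) pos_less_divide_eq) (simp_all add: add_nonneg_pos)
    qed
    finally have "t *\<^sub>R v \<in> V" by (simp add: V_def)
    moreover have "corner (t *\<^sub>R v) = 0"
      using v bounded_linear_corner by (simp add: M_space_eq linear_simps)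
    ultimately show "c t \<in> S" unfolding param using param_in_class_iff[OF S] by blast
  qed
  moreover have "c 0 = X" by (simp add: c_def)
  moreover have "vector_derivative c (at 0) = v"
    using vector_derivative_at[OF deriv[of 0]] by simp
  ultimately show ?thesis unfolding curve_velocities_def using e by blast
qed

lemma tangent_to_M_space:
  assumes S: "operator_class k m n S" "X \<in> S"
  shows "tangent_to S (M_space X) X"
  unfolding tangent_to_def
proof (intro conjI equalityI subsetI)
  show "subspace (M_space X)"
    using splitting_M_space by (simp add: splitting_def algebraic_complement_def)
  show "v \<in> curve_velocities S X" if "v \<in> M_space X" for v
    using curve_with_velocity[OF S that] .
  fix v assume "v \<in> curve_velocities S X"
  then obtain c e where c: "v = vector_derivative c (at 0)" "e > 0" "c C1_differentiable_on {-e<..<e}"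
    "c ` {-e<..<e} \<subseteq> S" "c 0 = X"
    unfolding curve_velocities_def by blast
  obtain D where "\<forall>t\<in>{-e<..<e}. (c has_vector_derivative D t) (at t)"
    using c(3) unfolding C1_differentiable_on_def by blast
  then have "(c has_vector_derivative v) (at 0)"
    using c(1,2) vector_derivative_at[of c "D 0" 0] by simp
  then show "v \<in> M_space X"
    using c by (intro velocity_in_M_space[OF S, where c = c and e = e]) (auto simp: image_subset_iff abs_less_iff)
qed

end

theorem theorem3p2:
  fixes S :: "('a::banach \<Rightarrow>\<^sub>L 'b::banach) set"
    and k m n :: nat
  assumes "S \<in> {rank_set k, Phi_fin_fin m n, Phi_fin_inf m, Phi_inf_fin n}"
  shows "smooth_submanifold S \<and> (\<forall>X\<in>S. tangent_to S (M_space X) X)"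
proof -
  have S: "operator_class k m n S" using assms by (simp add: operator_class_def)
  have inverse: "\<exists>A. generalized_inverse X A" if "X \<in> S" for X
    using operator_class_generalized_inverse[OF S that] unfolding generalized_inverse_def by metis
  have "smooth_submanifold S"
    unfolding smooth_submanifold_def
  proof
    fix X assume X: "X \<in> S"
    obtain A where "generalized_inverse X A" using inverse[OF X] by blast
    then interpret generalized_inverse X A .
    have "openin (top_of_set (M_space X)) (chart ` (S \<inter> W))"
      unfolding chart_image[OF S X] using open_V by (rule openin_open_Int)
    then show "\<exists>W V B0 B1 \<phi>. X \<in> W \<and> splitting B0 B1 \<and> smooth_diffeo W (V :: ('a \<Rightarrow>\<^sub>L 'b) set) \<phi> \<and>
        openin (top_of_set B0) (\<phi> ` (S \<inter> W))"
      using X_in_W splitting_M_space smooth_diffeo_chart by blast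
  qed
  moreover have "tangent_to S (M_space X) X" if "X \<in> S" for X
    using inverse[OF that] generalized_inverse.tangent_to_M_space[OF _ S that] by blast
  ultimately show ?thesis by blast
qed

end
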